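(* Let $M\ge 2$, let $Y$ be the state process described in the context (built from the price process $S$ and the counting processes $N^a,N^b$), and let $\mathbb{Y}$ be its signature. Fix $n\in\mathbb{N}$, a multi-index $J\in\{0,s,a,b\}^n$, and $j\in\{0,s,a,b\}$. If $M\ge n+1$, then for all $t\in[0,T]$, almost surely, $$\int_0^t \langle \epsilon_J,\mathbb{Y}_{u^-}\rangle\, dY^j_u=\langle (\epsilon_J;\epsilon_j)^{\sim},\mathbb{Y}_t\rangle ,$$ where the left-hand side is an It\^o integral and $(\epsilon_J;\epsilon_j)^{\sim}$ is the tilde transform defined in the context.
   Context: **Tensor algebra.** For $d\in\mathbb N$, $T((\mathbb R^d))$ is the set of sequences $\mathbf u=(\mathbf u^{(0)},\mathbf u^{(1)},\dots)$ with $\mathbf u^{(n)}\in(\mathbb R^d)^{\otimes n}$ (where $(\mathbb R^d)^{\otimes 0}:=\mathbb R$), and $T(\mathbb R^d)$ is the subset of sequences with finitely many nonzero entries. For a multi-index $J=(j_1,\dots,j_n)$ with entries in an index set (alphabet) of size $d$ labelling the canonical basis of $\mathbb R^d$, set $|J|:=n$ and $\epsilon_J:=\epsilon_{j_1}\otimes\cdots\otimes\epsilon_{j_n}$; $\epsilon_\emptyset$ is the basis element of $(\mathbb R^d)^{\otimes 0}$ and $|\emptyset|=0$. Set $J':=(j_1,\dots,j_{n-1})$ if $n>1$, $J':=\emptyset$ if $n=1$, and $J'':=(J')'$ for $n>1$, with the convention $\epsilon_{J''}=0$ for $n=1$. For $\mathbf x\in T((\mathbb R^d))$ write $\mathbf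 x_J=\langle\epsilon_J,\mathbf x\rangle$ for its $J$-coordinate, and for $\mathbf u\in T(\mathbb R^d)$, $\langle\mathbf u,\mathbf x\rangle:=\sum_{|J|\ge0}\mathbf u_J\mathbf x_J$ (a finite sum). **Signature of a càdlàg semimartingale.** Fix $T>0$. For an $\mathbb R^d$-valued càdlàg semimartingale $X=(X_t)_{t\in[0,T]}$, its signature is the $T((\mathbb R^d))$-valued process $\mathbb X=(\mathbb X_t)_{t\in[0,T]}$ with $\langle\epsilon_\emptyset,\mathbb X_t\rangle=1$ and, for each $J=(j_1,\dots,j_{|J|})$ with $|J|>0$, $$\langle \epsilon_J,\mathbb X_t\rangle=\int_0^t\langle\epsilon_{J'},\mathbb X_{u^-}\rangle\,dX^{j_{|J|}}_u+\frac12\,1_{\{|J|>1\}}\int_0^t\langle\epsilon_{J''},\mathbb X_{u^-}\rangle\,d[X^{j_{|J|-1}},X^{j_{|J|}}]^c_u+\sum_{0<u\le t}\ \sum_{\epsilon_{J_1}\otimes\epsilon_{J_2}=\epsilon_J}\frac{1}{|J_2|!}1_{\{|J_2|>1\}}\langle\epsilon_{J_1},\mathbb X_{u^-}\rangle\,\langle\epsilon_{J_2},(\Delta X_u)^{\otimes|J_2|}\rangle ,$$ where $[\cdot,\cdot]^c$ is the continuous part of the quadratic covariation and the integrals are It\^o integrals over $(0,t]$. **State process.** On a filtered probability space, $S=(S_t)_{t\in[0,T]}$ is a continuous real-valued semimartingale (the mid-price) and $N^a,N^b$ are adapted counting processes, i.e. nondecreasing càdlàg pure-jump processes with values in $\mathbb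 N$ (including $0$), started at $0$; their jumps need not be of size one. It is assumed that $\Delta N^a_t\,\Delta N^b_t=0$ for all $t$. For $M\ge2$ the state process $Y$ has components indexed by the alphabet $\mathcal A=\{0,s,qs,a,a^2,\dots,a^M,b,b^2,\dots,b^M\}$ (of size $3+2M$): $$Y^0_t=t,\quad Y^s_t=S_t,\quad Y^{qs}_t=[S]_t,\quad Y^a_t=N^a_t,\quad Y^b_t=N^b_t,\quad Y^{a^m}_t=\sum_{u\le t}(\Delta N^a_u)^m,\quad Y^{b^m}_t=\sum_{u\le t}(\Delta N^b_u)^m\quad(2\le m\le M).$$ $\mathbb Y$ denotes the signature of $Y$. **Tilde transform.** For a multi-index $J$ with entries in $\{0,s,a,b\}$ (last entry $j_{|J|}$ when $|J|>0$) and $j\in\{0,s,a,b\}$, define $$(\epsilon_J;\epsilon_j)^{\sim}:=\epsilon_J\otimes\epsilon_j-\tfrac12\,\epsilon_{J'}\otimes\epsilon_{qs}\,1_{\{j_{|J|}=j=s\}}+\sum_{\epsilon_{J_1}\otimes\epsilon_{J_2}=\epsilon_J}\boldsymbol\alpha(|J_2|)\,(\epsilon_{J_1}\otimes\epsilon_{a^{|J_2|+1}})\,1_{\{j=a\}}1_{\{J_2=(a,\dots,a)\}}+\sum_{\epsilon_{J_1}\otimes\epsilon_{J_2}=\epsilon_J}\boldsymbol\alpha(|J_2|)\,(\epsilon_{J_1}\otimes\epsilon_{b^{|J_2|+1}})\,1_{\{j=b\}}1_{\{J_2=(b,\dots,b)\}},$$ where, in the last two sums, $J_2$ ranges over nonempty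 suffixes of $J$, and $$\boldsymbol\alpha(r):=\sum_{k=1}^r(-1)^k\boldsymbol\alpha(r,k),\qquad \boldsymbol\alpha(r,k):=\sum_{(i_1,\dots,i_k)\in\mathcal I(r,k)}\ \prod_{l=1}^k\frac1{(i_l+1)!},$$ with $\mathcal I(r,k)$ the set of $(i_1,\dots,i_k)\in\mathbb N^k$ with all $i_l\ge1$ and $i_1+\dots+i_k=r$. *)

theory Defs
  imports "HOL-Probability.Probability" "HOL-Library.Poly_Mapping"
begin

section \<open>Stochastic calculus on a finite horizon\<close>

text \<open>
  A process is a function of time and outcome and matters only on \<open>[0,T]\<close>. A filtration on
  \<open>[0,T]\<close> is identified with its constant extension to all real times.
  The usual conditions are not imposed; accordingly, path properties are required almost surely,
  and integrals, covariations and signatures, which are determined only up to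
  indistinguishability, are predicates on processes rather than functions.
\<close>

type_synonym 'a process = "real \<Rightarrow> 'a \<Rightarrow> real"

locale filtered_prob_space = prob_space P + filtration "space P" F
  for P :: "'a measure" and F :: "real \<Rightarrow> 'a measure" +
  assumes subalg: "\<And>t. subalgebra P (F t)"

definition adapted :: "(real \<Rightarrow> 'a measure) \<Rightarrow> real \<Rightarrow> 'a process \<Rightarrow> bool" where
  "adapted F T X \<longleftrightarrow> (\<forall>t\<in>{0..T}. X t \<in> borel_measurable (F t))"

definition indistinguishable :: "'a measure \<Rightarrow> real \<Rightarrow> 'a process \<Rightarrow> 'a process \<Rightarrow> bool" where
  "indistinguishable P T X Y \<longleftrightarrow> (AE \<omega> in P. \<forall>t\<in>{0..T}. X t \<omega> = Y t \<omega>)"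

definition left_lim :: "(real \<Rightarrow> real) \<Rightarrow> real \<Rightarrow> real" where
  "left_lim f t = Lim (at_left t) f"

text \<open>Only used at times \<open>t > 0\<close>.\<close>

definition jump :: "(real \<Rightarrow> real) \<Rightarrow> real \<Rightarrow> real" where
  "jump f t = f t - left_lim f t"

definition cadlag_path :: "real \<Rightarrow> (real \<Rightarrow> real) \<Rightarrow> bool" where
  "cadlag_path T f \<longleftrightarrow>
     (\<forall>t\<in>{0..<T}. (f \<longlongrightarrow> f t) (at_right t)) \<and> (\<forall>t\<in>{0<..T}. \<exists>l. (f \<longlongrightarrow> l) (at_left t))"

definition bv_path :: "real \<Rightarrow> (real \<Rightarrow> real) \<Rightarrow> bool" where
  "bv_path T f \<longleftrightarrow> (\<exists>C. \<forall>k (p :: nat \<Rightarrow> real). mono p \<and> range p \<subseteq> {0..T} \<longrightarrow>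
     (\<Sum>i<k. \<bar>f (p (Suc i)) - f (p i)\<bar>) \<le> C)"

definition cadlag_process :: "'a measure \<Rightarrow> (real \<Rightarrow> 'a measure) \<Rightarrow> real \<Rightarrow> 'a process \<Rightarrow> bool" where
  "cadlag_process P F T X \<longleftrightarrow> adapted F T X \<and> (AE \<omega> in P. cadlag_path T (\<lambda>t. X t \<omega>))"

definition martingale :: "'a measure \<Rightarrow> (real \<Rightarrow> 'a measure) \<Rightarrow> real \<Rightarrow> 'a process \<Rightarrow> bool" where
  "martingale P F T X \<longleftrightarrow> adapted F T X \<and> (\<forall>t\<in>{0..T}. integrable P (X t)) \<and>
     (\<forall>s t. 0 \<le> s \<and> s \<le> t \<and> t \<le> T \<longrightarrow> (AE \<omega> in P. real_cond_exp P (F s) (X t) \<omega> = X s \<omega>))"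

text \<open>
  The stopped process is asked to be a martingale up to indistinguishability, because without
  completeness of the filtration a stopped process need not be adapted outside the set of
  regular paths.
\<close>

definition local_martingale :: "'a measure \<Rightarrow> (real \<Rightarrow> 'a measure) \<Rightarrow> real \<Rightarrow> 'a process \<Rightarrow> bool" where
  "local_martingale P F T X \<longleftrightarrow> cadlag_process P F T X \<and>
     (\<exists>\<tau> :: nat \<Rightarrow> 'a \<Rightarrow> real.
        (\<forall>n. stopping_time F (\<tau> n) \<and> (\<forall>\<omega>\<in>space P. 0 \<le> \<tau> n \<omega>)) \<and>
        (AE \<omega> in P. (\<forall>n. \<tau> n \<omega> \<le> \<tau> (Suc n) \<omega>) \<and> (\<exists>n. T \<le> \<tau> n \<omega>)) \<and>
        (\<forall>n. \<exists>N. martingale P F T N \<and>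
           indistinguishable P T N (\<lambda>t \<omega>. X (min t (\<tau> n \<omega>)) \<omega> - X 0 \<omega>)))"

definition semimartingale :: "'a measure \<Rightarrow> (real \<Rightarrow> 'a measure) \<Rightarrow> real \<Rightarrow> 'a process \<Rightarrow> bool" where
  "semimartingale P F T X \<longleftrightarrow> cadlag_process P F T X \<and>
     (\<exists>L V. local_martingale P F T L \<and>
        cadlag_process P F T V \<and> (AE \<omega> in P. bv_path T (\<lambda>t. V t \<omega>)) \<and>
        indistinguishable P T X (\<lambda>t \<omega>. L t \<omega> + V t \<omega>))"

text \<open>
  A list of triples \<open>(r, s, \<xi>)\<close> represents the elementary predictable process
  \<open>\<Sum> \<xi> 1\<^bsub>(r,s]\<^esub>\<close>.
\<close>

type_synonym 'a elementary = "(real \<times> real \<times> ('a \<Rightarrow> real)) list"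

definition elementary :: "(real \<Rightarrow> 'a measure) \<Rightarrow> real \<Rightarrow> 'a elementary \<Rightarrow> bool" where
  "elementary F T h \<longleftrightarrow>
     (\<forall>(r, s, \<xi>)\<in>set h. 0 \<le> r \<and> r \<le> s \<and> s \<le> T \<and> \<xi> \<in> borel_measurable (F r))"

definition elem_process :: "'a elementary \<Rightarrow> 'a process" where
  "elem_process h t \<omega> = (\<Sum>(r, s, \<xi>)\<leftarrow>h. \<xi> \<omega> * indicator {r<..s} t)"

definition elem_integral :: "'a elementary \<Rightarrow> 'a process \<Rightarrow> 'a process" where
  "elem_integral h X t \<omega> = (\<Sum>(r, s, \<xi>)\<leftarrow>h. \<xi> \<omega> * (X (min s t) \<omega> - X (min r t) \<omega>))"

text \<open>
  Convergence in probability, uniformly on \<open>[0,T]\<close>. The outer measure spares a measurability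
  condition on the uncountable union over \<open>t\<close>.
\<close>

definition ucp_limit :: "'a measure \<Rightarrow> real \<Rightarrow> (nat \<Rightarrow> 'a process) \<Rightarrow> 'a process \<Rightarrow> bool" where
  "ucp_limit P T Z Z' \<longleftrightarrow> (\<forall>\<epsilon>>0.
     (\<lambda>n. outer_measure_of P {\<omega>\<in>space P. \<exists>t\<in>{0..T}. \<epsilon> < \<bar>Z n t \<omega> - Z' t \<omega>\<bar>}) \<longlonglongrightarrow> 0)"

text \<open>
  \<open>I\<close> is the It\^o integral \<open>\<integral>\<^bsub>(0,t]\<^esub> Z\<^bsub>u-\<^esub> dX\<^sub>u\<close> of the left limits of a cadlag adapted process \<open>Z\<close>:
  the extension of the elementary integral along dominated pointwise convergence of integrands.
  Domination of \<open>h n\<close> by a locally bounded process is expressed by pathwise boundedness, uniformly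
  in \<open>n\<close>: the running supremum over all \<open>h n\<close> is then left-continuous, increasing and adapted.
  The dyadic discretizations of \<open>Z\<close> form an admissible sequence \<open>h\<close>, hence \<open>I\<close> is unique up to
  indistinguishability; for a semimartingale \<open>X\<close> it exists by the stochastic dominated convergence
  theorem.
\<close>

definition ito_integral ::
  "'a measure \<Rightarrow> (real \<Rightarrow> 'a measure) \<Rightarrow> real \<Rightarrow> 'a process \<Rightarrow> 'a process \<Rightarrow> 'a process \<Rightarrow> bool" where
  "ito_integral P F T Z X I \<longleftrightarrow> cadlag_process P F T Z \<and> cadlag_process P F T I \<and>
     (\<forall>h :: nat \<Rightarrow> 'a elementary.
        (\<forall>n. elementary F T (h n)) \<and>
        (AE \<omega> in P. \<forall>t\<in>{0<..T}. (\<lambda>n. elem_process (h n) t \<omega>) \<longlonglongrightarrow> left_lim (\<lambda>t. Z t \<omega>) t) \<and>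
        (AE \<omega> in P. \<exists>C. \<forall>n. \<forall>t\<in>{0<..T}. \<bar>elem_process (h n) t \<omega>\<bar> \<le> C)
        \<longrightarrow> ucp_limit P T (\<lambda>n. elem_integral (h n) X) I)"

text \<open>Quadratic covariation \<open>[X,Y]\<close>, normalized by \<open>[X,Y]\<^sub>0 = 0\<close>.\<close>

definition quad_covariation ::
  "'a measure \<Rightarrow> (real \<Rightarrow> 'a measure) \<Rightarrow> real \<Rightarrow> 'a process \<Rightarrow> 'a process \<Rightarrow> 'a process \<Rightarrow> bool" where
  "quad_covariation P F T X Y Q \<longleftrightarrow> cadlag_process P F T Q \<and>
     (\<exists>I I'. ito_integral P F T X Y I \<and> ito_integral P F T Y X I' \<and>
        indistinguishable P T Q (\<lambda>t \<omega>. X t \<omega> * Y t \<omega> - X 0 \<omega> * Y 0 \<omega> - I t \<omega> - I' t \<omega>))"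

definition quad_covariation_cont ::
  "'a measure \<Rightarrow> (real \<Rightarrow> 'a measure) \<Rightarrow> real \<Rightarrow> 'a process \<Rightarrow> 'a process \<Rightarrow> 'a process \<Rightarrow> bool" where
  "quad_covariation_cont P F T X Y C \<longleftrightarrow> cadlag_process P F T C \<and>
     (\<exists>Q. quad_covariation P F T X Y Q \<and>
        indistinguishable P T C
          (\<lambda>t \<omega>. Q t \<omega> - (\<Sum>\<^sub>\<infinity>u\<in>{0<..t}. jump (\<lambda>v. X v \<omega>) u * jump (\<lambda>v. Y v \<omega>) u)))"

section \<open>Tensor algebra and signature\<close>

text \<open>
  Multi-indices over an alphabet \<open>'i\<close> are lists. In coordinates, an element of the extended tensor
  algebra is a function on multi-indices, and an element of the tensor algebra is a finitely
  supported one; the product of basis elements is concatenation of their indices, and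
  \<^term>\<open>butlast J\<close> is the multi-index \<open>J'\<close>.
\<close>

abbreviation basis :: "'i list \<Rightarrow> 'i list \<Rightarrow>\<^sub>0 real" where
  "basis J \<equiv> Poly_Mapping.single J 1"

definition scale :: "real \<Rightarrow> ('i list \<Rightarrow>\<^sub>0 real) \<Rightarrow> 'i list \<Rightarrow>\<^sub>0 real" where
  "scale c u = Poly_Mapping.map ((*) c) u"

definition pairing :: "('i list \<Rightarrow>\<^sub>0 real) \<Rightarrow> ('i list \<Rightarrow> real) \<Rightarrow> real" where
  "pairing u x = (\<Sum>J\<in>Poly_Mapping.keys u. Poly_Mapping.lookup u J * x J)"

definition jump_term ::
  "('i \<Rightarrow> 'a process) \<Rightarrow> ('i list \<Rightarrow> 'a process) \<Rightarrow> 'i list \<Rightarrow> real \<Rightarrow> 'a \<Rightarrow> real" where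
  "jump_term X XX J u \<omega> = (\<Sum>(J1, J2) | J1 @ J2 = J.
     1 / fact (length J2) * of_bool (1 < length J2) * left_lim (\<lambda>v. XX J1 v \<omega>) u *
     (\<Prod>i\<leftarrow>J2. jump (\<lambda>v. X i v \<omega>) u))"

definition signature ::
  "'a measure \<Rightarrow> (real \<Rightarrow> 'a measure) \<Rightarrow> real \<Rightarrow> 'i set \<Rightarrow> ('i \<Rightarrow> 'a process) \<Rightarrow>
   ('i list \<Rightarrow> 'a process) \<Rightarrow> bool" where
  "signature P F T A X XX \<longleftrightarrow>
     (\<forall>J\<in>lists A. cadlag_process P F T (XX J)) \<and>
     indistinguishable P T (XX []) (\<lambda>t \<omega>. 1) \<and>
     (\<forall>J\<in>lists A. J \<noteq> [] \<longrightarrow> (\<exists>I K.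
        ito_integral P F T (XX (butlast J)) (X (last J)) I \<and>
        (1 < length J \<longrightarrow> (\<exists>C.
           quad_covariation_cont P F T (X (last (butlast J))) (X (last J)) C \<and>
           ito_integral P F T (XX (butlast (butlast J))) C K)) \<and>
        indistinguishable P T (XX J)
          (\<lambda>t \<omega>. I t \<omega> + 1 / 2 * of_bool (1 < length J) * K t \<omega> +
             (\<Sum>\<^sub>\<infinity>u\<in>{0<..t}. jump_term X XX J u \<omega>))))"

section \<open>State process\<close>

text \<open>\<open>La m\<close> and \<open>Lb m\<close> are the letters \<open>a\<^sup>m\<close> and \<open>b\<^sup>m\<close>; in particular \<open>a\<close> is \<open>La 1\<close>.\<close>

datatype letter = L0 | Ls | Lqs | La nat | Lb nat

definition alphabet :: "nat \<Rightarrow> letter set" where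
  "alphabet M = {L0, Ls, Lqs} \<union> La ` {1..M} \<union> Lb ` {1..M}"

text \<open>A cadlag path with values in the naturals is automatically pure-jump.\<close>

definition counting_process :: "'a measure \<Rightarrow> (real \<Rightarrow> 'a measure) \<Rightarrow> real \<Rightarrow> 'a process \<Rightarrow> bool" where
  "counting_process P F T N \<longleftrightarrow> cadlag_process P F T N \<and>
     (AE \<omega> in P. N 0 \<omega> = 0 \<and> mono_on {0..T} (\<lambda>t. N t \<omega>) \<and> (\<forall>t\<in>{0..T}. N t \<omega> \<in> \<nat>))"

definition power_jumps :: "nat \<Rightarrow> 'a process \<Rightarrow> 'a process" where
  "power_jumps m N t \<omega> = (if m = 1 then N t \<omega> else (\<Sum>\<^sub>\<infinity>u\<in>{0<..t}. jump (\<lambda>v. N v \<omega>) u ^ m))"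

fun state_process ::
  "'a process \<Rightarrow> 'a process \<Rightarrow> 'a process \<Rightarrow> 'a process \<Rightarrow> letter \<Rightarrow> 'a process" where
  "state_process S QS Na Nb L0 = (\<lambda>t \<omega>. t)"
| "state_process S QS Na Nb Ls = S"
| "state_process S QS Na Nb Lqs = QS"
| "state_process S QS Na Nb (La m) = power_jumps m Na"
| "state_process S QS Na Nb (Lb m) = power_jumps m Nb"

section \<open>Tilde transform\<close>

definition compositions :: "nat \<Rightarrow> nat \<Rightarrow> nat list set" where
  "compositions r k = {is. length is = k \<and> (\<forall>i\<in>set is. 1 \<le> i) \<and> sum_list is = r}"

definition alpha2 :: "nat \<Rightarrow> nat \<Rightarrow> real" where
  "alpha2 r k = (\<Sum>is\<in>compositions r k. \<Prod>i\<leftarrow>is. 1 / fact (i + 1))"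

definition alpha :: "nat \<Rightarrow> real" where
  "alpha r = (\<Sum>k=1..r. (-1) ^ k * alpha2 r k)"

definition tilde :: "letter list \<Rightarrow> letter \<Rightarrow> letter list \<Rightarrow>\<^sub>0 real" where
  "tilde J j =
     basis (J @ [j])
     - (if J \<noteq> [] \<and> last J = Ls \<and> j = Ls then scale (1 / 2) (basis (butlast J @ [Lqs])) else 0)
     + (\<Sum>(J1, J2) | J1 @ J2 = J \<and> J2 \<noteq> [].
          if j = La 1 \<and> set J2 \<subseteq> {La 1}
          then scale (alpha (length J2)) (basis (J1 @ [La (length J2 + 1)])) else 0)
     + (\<Sum>(J1, J2) | J1 @ J2 = J \<and> J2 \<noteq> [].
          if j = Lb 1 \<and> set J2 \<subseteq> {Lb 1}
          then scale (alpha (length J2)) (basis (J1 @ [Lb (length J2 + 1)])) else 0)"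

end

theory Submission
  imports Defs
begin

text \<open>
  By definition of the signature, the coordinate of \<open>J @ [j]\<close> is the Ito integral of the coordinate of
  \<open>J\<close> against the component \<open>j\<close>, plus half an integral against the continuous covariation of the last
  two components, plus a sum over the jumps. The tilde transform undoes these two corrections.

  Each Ito integral is an almost sure uniform limit of dyadic Riemann sums along a subsequence
  (\<open>ito_integral_riemann\<close>). All integrals and covariations that matter are therefore determined
  path by path, by elementary estimates. A cadlag path is a uniform limit of step paths
  (\<open>cadlag_path_approx_step\<close>), whence its covariation with a step path or with a continuous
  nondecreasing path is the sum of the products of the jumps (\<open>covsum_tame_tendsto\<close>). Time, the
  counting processes and their power sums are of this kind, and so is the quadratic variation
  of the continuous process \<open>S\<close> (\<open>quad_variation_continuous_mono\<close>). Hence the covariation correction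
  is present only when the last two letters are both \<open>s\<close>; it then is half the coordinate of
  \<open>butlast J @ [Lqs]\<close>, the term that the tilde transform subtracts.

  The jump correction is absent when \<open>j\<close> is time or price. When \<open>j\<close> is \<open>a\<close>, let \<open>R\<close> be the number of
  letters \<open>a\<close> at the end of \<open>J\<close>, let \<open>J(r)\<close> be \<open>J\<close> without its last \<open>r\<close> letters, and put
  \<open>W q = \<Sum>\<^sub>u YY (J(q)) (u-) (\<Delta>N u)\<^sup>q\<^sup>+\<^sup>1\<close>. As \<open>a\<close> never jumps together with \<open>b\<close>, time or price, only
  suffixes consisting of \<open>a\<close> contribute to the jump term, and the coordinate of \<open>J(r) @ [La (r + 1)]\<close> is
  \<open>\<Sum>\<^sub>p W (r + p) / (p + 1)!\<close> with \<open>p \<le> R - r\<close> (\<open>signature_snoc_counting\<close>). The integral sought is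
  \<open>W 0\<close>. Since the generating function of \<open>1 / (p + 1)!\<close> is \<open>(exp x - 1) / x\<close> and that of \<open>\<alpha>\<close>, with
  \<open>\<alpha>(0) = 1\<close>, is its inverse, weighting these coordinates with \<open>\<alpha>(r)\<close> recovers \<open>W 0\<close>
  (\<open>alpha_inversion\<close>). The case of \<open>b\<close> is the same.
\<close>

section \<open>Cadlag paths and step paths\<close>

text \<open>
  The witnesses \<open>D\<close> and \<open>c\<close> are kept as arguments: \<open>D\<close> may contain times with \<open>c u = 0\<close>, so that it
  can serve several paths at once, as it does below for a counting path and its power sums.
\<close>

definition step_path :: "real \<Rightarrow> (real \<Rightarrow> real) \<Rightarrow> real set \<Rightarrow> (real \<Rightarrow> real) \<Rightarrow> bool" where
  "step_path T x D c \<longleftrightarrow> finite D \<and> D \<subseteq> {0<..T} \<and>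
     (\<forall>t\<in>{0..T}. x t = x 0 + (\<Sum>u\<in>D \<inter> {..t}. c u))"

lemma step_pathD:
  assumes "step_path T x D c"
  shows "finite D" "D \<subseteq> {0<..T}" "t \<in> {0..T} \<Longrightarrow> x t = x 0 + (\<Sum>u\<in>D \<inter> {..t}. c u)"
  using assms unfolding step_path_def by blast+

lemma left_lim_eqI: "(f \<longlongrightarrow> l) (at_left t) \<Longrightarrow> left_lim f t = l" for t :: real
  unfolding left_lim_def by (rule tendsto_Lim) auto

lemma cadlag_path_left_lim:
  assumes "cadlag_path T x" "0 < u" "u \<le> T"
  shows "(x \<longlongrightarrow> left_lim x u) (at_left u)"
proof -
  obtain l where l: "(x \<longlongrightarrow> l) (at_left u)"
    using assms unfolding cadlag_path_def by fastforce
  then show ?thesis using left_lim_eqI by blast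
qed

lemma eventually_finite_set_at_left:
  fixes u :: real
  assumes "finite D"
  shows "\<forall>\<^sub>F v in at_left u. D \<inter> {..v} = D \<inter> {..<u}"
proof -
  have "\<forall>\<^sub>F v in at_left u. \<forall>d\<in>D. d < u \<longrightarrow> d \<le> v"
  proof (rule eventually_ball_finite[OF assms], rule ballI)
    fix d show "\<forall>\<^sub>F v in at_left u. d < u \<longrightarrow> d \<le> v"
    proof (cases "d < u")
      case True
      then show ?thesis
        using eventually_at_left_real[of d u] by (auto elim!: eventually_mono)
    qed auto
  qed
  moreover have "\<forall>\<^sub>F v in at_left u. v < u"
    by (simp add: eventually_at_filter)
  ultimately show ?thesis
    by eventually_elim (auto intro: less_imp_le)
qed

lemma step_path_left_lim:
  assumes "step_path T x D c" "0 < u" "u \<le> T"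
  shows "left_lim x u = x 0 + (\<Sum>v\<in>D \<inter> {..<u}. c v)"
proof (rule left_lim_eqI)
  have fin: "finite D" and eq: "\<And>t. t \<in> {0..T} \<Longrightarrow> x t = x 0 + (\<Sum>u\<in>D \<inter> {..t}. c u)"
    using step_pathD[OF assms(1)] by blast+
  have "\<forall>\<^sub>F v in at_left u. v \<in> {0<..<u}"
    using assms eventually_at_left_real[of 0 u] by auto
  then have "\<forall>\<^sub>F v in at_left u. x 0 + (\<Sum>v\<in>D \<inter> {..<u}. c v) = x v"
    using eventually_finite_set_at_left[OF fin, of u]
  proof eventually_elim
    case (elim v)
    then show ?case using eq[of v] assms by auto
  qed
  then show "(x \<longlongrightarrow> x 0 + (\<Sum>v\<in>D \<inter> {..<u}. c v)) (at_left u)"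
    by (rule Lim_transform_eventually[OF tendsto_const])
qed

lemma step_path_jump:
  assumes "step_path T x D c" "0 < u" "u \<le> T"
  shows "jump x u = (if u \<in> D then c u else 0)"
proof -
  have fin: "finite D" and eq: "x u = x 0 + (\<Sum>v\<in>D \<inter> {..u}. c v)"
    using step_pathD(1)[OF assms(1)] step_pathD(3)[OF assms(1), of u] assms(2,3) by simp_all
  have "(\<Sum>v\<in>D \<inter> {..u}. c v) = (\<Sum>v\<in>D \<inter> {..<u}. c v) + (if u \<in> D then c u else 0)"
  proof (cases "u \<in> D")
    case True
    then have "D \<inter> {..u} = insert u (D \<inter> {..<u})" by (auto simp: order.strict_iff_order)
    then show ?thesis using True fin by simp
  next
    case False
    then have "D \<inter> {..u} = D \<inter> {..<u}" by (auto simp: order.strict_iff_order)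
    then show ?thesis using False by simp
  qed
  then show ?thesis
    unfolding jump_def step_path_left_lim[OF assms] eq by simp
qed

text \<open>
  A compactness argument: the local hypothesis says that \<open>x\<close> varies by at most \<open>e\<close> just before
  \<open>v\<close> and by at most \<open>e\<close> from \<open>v\<close> on, so a step path with jumps at \<open>v\<close> and at the right end point
  approximates it near \<open>v\<close>, and such approximations concatenate. Admitting \<open>e = 0\<close> covers the
  paths that are themselves step paths.
\<close>

lemma step_approximation:
  assumes "0 \<le> T" and "0 \<le> e"
    and near: "\<And>v. v \<in> {0..T} \<Longrightarrow> \<exists>d>0. 
       (\<forall>s\<in>{0..T}. \<forall>t\<in>{0..T}. v - d < s \<and> s < v \<and> v - d < t \<and> t < v \<longrightarrow> \<bar>x t - x s\<bar> \<le> e) \<and>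
       (\<forall>t\<in>{0..T}. v \<le> t \<and> t < v + d \<longrightarrow> \<bar>x t - x v\<bar> \<le> e)"
  shows "\<exists>g D c. step_path T g D c \<and> g 0 = x 0 \<and> (\<forall>t\<in>{0..T}. \<bar>x t - g t\<bar> \<le> e)"
proof -
  \<comment> \<open>Exactness at \<open>b\<close> lets the approximation on the next interval start from the right value.\<close>
  define Q where "Q a b D c \<longleftrightarrow> finite D \<and> D \<subseteq> {a<..b} \<and>
     (\<forall>t\<in>{a..b}. \<bar>x t - (x a + (\<Sum>u\<in>D \<inter> {..t}. c u))\<bar> \<le> e) \<and> x b = x a + (\<Sum>u\<in>D. c u)"
    for a b D and c :: "real \<Rightarrow> real"
  define R where "R a b \<longleftrightarrow> (0 \<le> a \<and> a \<le> b \<and> b \<le> T \<longrightarrow> (\<exists>D c. Q a b D c))" for a b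
  have "R 0 T"
    using \<open>0 \<le> T\<close>
  proof (induction rule: Bolzano)
    case (trans a b c)
    show ?case unfolding R_def
    proof (intro impI)
      assume "0 \<le> a \<and> a \<le> c \<and> c \<le> T"
      then obtain D1 c1 D2 c2 where 1: "Q a b D1 c1" and 2: "Q b c D2 c2"
        using trans unfolding R_def by force
      define f where "f u = (if u \<le> b then c1 u else c2 u)" for u
      have disj: "D1 \<inter> D2 = {}" and fin: "finite D1" "finite D2"
        using 1 2 by (force simp: Q_def)+
      have f1: "(\<Sum>u\<in>A. f u) = (\<Sum>u\<in>A. c1 u)" if "A \<subseteq> D1" for A
        using that 1 by (intro sum.cong) (auto simp: Q_def f_def)
      have f2: "(\<Sum>u\<in>A. f u) = (\<Sum>u\<in>A. c2 u)" if "A \<subseteq> D2" for A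
        using that 2 by (intro sum.cong) (auto simp: Q_def f_def)
      have tot: "(\<Sum>u\<in>D1 \<union> D2. f u) = (\<Sum>u\<in>D1. c1 u) + (\<Sum>u\<in>D2. c2 u)"
        using disj fin f1[of D1] f2[of D2] by (simp add: sum.union_disjoint)
      have "\<bar>x t - (x a + (\<Sum>u\<in>(D1 \<union> D2) \<inter> {..t}. f u))\<bar> \<le> e" if t: "t \<in> {a..c}" for t
      proof (cases "t \<le> b")
        case True
        then have "(D1 \<union> D2) \<inter> {..t} = D1 \<inter> {..t}" using 2 by (auto simp: Q_def)
        then show ?thesis using 1 t True f1[of "D1 \<inter> {..t}"] by (auto simp: Q_def)
      next
        case False
        then have "(D1 \<union> D2) \<inter> {..t} = D1 \<union> (D2 \<inter> {..t})" using 1 by (auto simp: Q_def)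
        moreover have "(\<Sum>u\<in>D1 \<union> (D2 \<inter> {..t}). f u) = (\<Sum>u\<in>D1. c1 u) + (\<Sum>u\<in>D2 \<inter> {..t}. c2 u)"
          using disj fin f1[of D1] f2[of "D2 \<inter> {..t}"] by (subst sum.union_disjoint) auto
        ultimately show ?thesis using 1 2 t False by (auto simp: Q_def add.assoc)
      qed
      then have "Q a c (D1 \<union> D2) f"
        using 1 2 tot fin trans by (auto simp: Q_def)
      then show "\<exists>D c'. Q a c D c'" by blast
    qed
  next
    case (local v)
    obtain d where d: "d > 0"
      "\<And>s t. s\<in>{0..T} \<Longrightarrow> t\<in>{0..T} \<Longrightarrow> v - d < s \<Longrightarrow> s < v \<Longrightarrow> v - d < t \<Longrightarrow> t < v \<Longrightarrow> \<bar>x t - x s\<bar> \<le> e"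
      "\<And>t. t\<in>{0..T} \<Longrightarrow> v \<le> t \<Longrightarrow> t < v + d \<Longrightarrow> \<bar>x t - x v\<bar> \<le> e"
      using near[of v] local by auto
    have "R a b" if ab: "a \<le> v" "v \<le> b" "b - a < d" for a b
      unfolding R_def
    proof (intro impI)
      assume T: "0 \<le> a \<and> a \<le> b \<and> b \<le> T"
      define D where "D = {v, b} - {a}"
      define f where "f u = (if u = v then x v - x a else x b - x v)" for u
      have tot: "x b = x a + (\<Sum>u\<in>D. f u)"
        using ab by (cases "a = v"; cases "v = b"; cases "a = b") (auto simp: D_def f_def insert_Diff_if)
      have "\<bar>x t - (x a + (\<Sum>u\<in>D \<inter> {..t}. f u))\<bar> \<le> e" if t: "t \<in> {a..b}" for t
      proof -
        consider "t < v" | "v \<le> t" "t < b" | "t = b" using t by force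
        then show ?thesis
        proof cases
          case 1
          then have "D \<inter> {..t} = {}" using ab by (auto simp: D_def)
          then show ?thesis using d(2)[of a t] 1 t T ab by auto
        next
          case 2
          then have "D \<inter> {..t} = {v} - {a}" using ab by (auto simp: D_def)
          then have "(\<Sum>u\<in>D \<inter> {..t}. f u) = x v - x a"
            by (cases "a = v") (auto simp: f_def)
          then show ?thesis using d(3)[of t] 2 t T ab by auto
        next
          case 3
          then have "D \<inter> {..t} = D" using ab by (auto simp: D_def)
          then show ?thesis using 3 tot \<open>0 \<le> e\<close> by simp
        qed
      qed
      then have "Q a b D f" using tot ab T by (auto simp: Q_def D_def)
      then show "\<exists>D c. Q a b D c" by blast
    qed
    then show ?case using d(1) by blast
  qed
  then obtain D c where Q: "Q 0 T D c" using \<open>0 \<le> T\<close> by (auto simp: R_def)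
  define g where "g t = x 0 + (\<Sum>u\<in>D \<inter> {..t}. c u)" for t
  have "D \<inter> {..0} = {}" using Q by (auto simp: Q_def)
  then have "g 0 = x 0" by (simp add: g_def)
  moreover have "step_path T g D c"
    unfolding step_path_def \<open>g 0 = x 0\<close> using Q by (auto simp: g_def Q_def)
  moreover have "\<forall>t\<in>{0..T}. \<bar>x t - g t\<bar> \<le> e"
    using Q by (auto simp: Q_def g_def)
  ultimately show ?thesis by blast
qed

lemma cadlag_path_near:
  assumes x: "cadlag_path T x" and "0 < e" and v: "v \<in> {0..T}"
  shows "\<exists>d>0. 
       (\<forall>s\<in>{0..T}. \<forall>t\<in>{0..T}. v - d < s \<and> s < v \<and> v - d < t \<and> t < v \<longrightarrow> \<bar>x t - x s\<bar> \<le> e) \<and>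
       (\<forall>t\<in>{0..T}. v \<le> t \<and> t < v + d \<longrightarrow> \<bar>x t - x v\<bar> \<le> e)"
proof -
  obtain d1 where d1: "d1 > 0"
    "\<And>s t. s\<in>{0..T} \<Longrightarrow> t\<in>{0..T} \<Longrightarrow> v - d1 < s \<Longrightarrow> s < v \<Longrightarrow> v - d1 < t \<Longrightarrow> t < v \<Longrightarrow> \<bar>x t - x s\<bar> \<le> e"
  proof (cases "v = 0")
    case True
    then show ?thesis using that[of 1] by auto
  next
    case False
    then have "(x \<longlongrightarrow> left_lim x v) (at_left v)"
      using cadlag_path_left_lim[OF x] v by auto
    then have "\<forall>\<^sub>F t in at_left v. dist (x t) (left_lim x v) < e / 2"
      using \<open>0 < e\<close> by (intro tendstoD) auto
    then obtain b where b: "b < v" "\<And>t. b < t \<Longrightarrow> t < v \<Longrightarrow> dist (x t) (left_lim x v) < e / 2"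
      by (auto simp: eventually_at_left_field)
    show ?thesis
    proof (rule that[of "v - b"])
      fix s t assume "v - (v - b) < s" "s < v" "v - (v - b) < t" "t < v"
      then have "\<bar>x s - left_lim x v\<bar> < e / 2" "\<bar>x t - left_lim x v\<bar> < e / 2"
        using b(2)[of s] b(2)[of t] by (simp_all add: dist_real_def)
      then show "\<bar>x t - x s\<bar> \<le> e" by arith
    qed (use b in auto)
  qed
  obtain d2 where d2: "d2 > 0" "\<And>t. t\<in>{0..T} \<Longrightarrow> v \<le> t \<Longrightarrow> t < v + d2 \<Longrightarrow> \<bar>x t - x v\<bar> \<le> e"
  proof (cases "v = T")
    case True
    then show ?thesis using that[of 1] \<open>0 < e\<close> by auto
  next
    case False
    then have "(x \<longlongrightarrow> x v) (at_right v)" using x v by (auto simp: cadlag_path_def)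
    then have "\<forall>\<^sub>F t in at_right v. dist (x t) (x v) < e"
      using \<open>0 < e\<close> by (intro tendstoD) auto
    then obtain b where b: "b > v" "\<And>t. v < t \<Longrightarrow> t < b \<Longrightarrow> dist (x t) (x v) < e"
      by (auto simp: eventually_at_right_field)
    show ?thesis
    proof (rule that[of "b - v"])
      fix t assume "v \<le> t" "t < v + (b - v)"
      then show "\<bar>x t - x v\<bar> \<le> e" using b(2)[of t] \<open>0 < e\<close> by (cases "t = v") (auto simp: dist_real_def)
    qed (use b in auto)
  qed
  show ?thesis
    by (rule exI[of _ "min d1 d2"]) (use d1 d2 in auto)
qed

lemma cadlag_path_approx_step:
  assumes "cadlag_path T x" "0 \<le> T" "0 < e"
  obtains g D c where "step_path T g D c" "\<And>t. t \<in> {0..T} \<Longrightarrow> \<bar>x t - g t\<bar> \<le> e"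
  using step_approximation[of T e x] cadlag_path_near[OF assms(1,3)] assms(2,3) by auto

lemma cadlag_path_bounded:
  assumes "cadlag_path T x" "0 \<le> T"
  obtains C where "\<And>t. t \<in> {0..T} \<Longrightarrow> \<bar>x t\<bar> \<le> C"
proof -
  obtain g D c where g: "step_path T g D c" "\<And>t. t \<in> {0..T} \<Longrightarrow> \<bar>x t - g t\<bar> \<le> 1"
    using cadlag_path_approx_step[OF assms, of 1] by auto
  have "\<bar>x t\<bar> \<le> 1 + \<bar>g 0\<bar> + (\<Sum>u\<in>D. \<bar>c u\<bar>)" if t: "t \<in> {0..T}" for t
  proof -
    have "\<bar>\<Sum>u\<in>D \<inter> {..t}. c u\<bar> \<le> (\<Sum>u\<in>D \<inter> {..t}. \<bar>c u\<bar>)" by (rule sum_abs)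
    also have "\<dots> \<le> (\<Sum>u\<in>D. \<bar>c u\<bar>)" using step_pathD(1)[OF g(1)] by (intro sum_mono2) auto
    finally have "\<bar>\<Sum>u\<in>D \<inter> {..t}. c u\<bar> \<le> (\<Sum>u\<in>D. \<bar>c u\<bar>)" .
    moreover have "g t = g 0 + (\<Sum>u\<in>D \<inter> {..t}. c u)" using step_pathD(3)[OF g(1) t] .
    ultimately show ?thesis using g(2)[OF t] by auto
  qed
  then show ?thesis using that by blast
qed

lemma Nats_close_eq:
  assumes "(a::real) \<in> \<nat>" "b \<in> \<nat>" "\<bar>a - b\<bar> \<le> 1 / 2" shows "a = b"
proof -
  obtain m n where mn: "a = real m" "b = real n" using assms by (auto elim!: Nats_cases)
  then have "\<bar>real_of_int (int m - int n)\<bar> < 1" using assms(3) by simp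
  then have "int m = int n" by linarith
  then show ?thesis using mn by simp
qed

text \<open>
  A one-sided limit of a path with natural values makes the path constant on that side, so the
  local variation is \<open>0\<close>.
\<close>

lemma nat_valued_cadlag_step:
  assumes x: "cadlag_path T x" and "0 \<le> T" and nat: "\<And>t. t \<in> {0..T} \<Longrightarrow> x t \<in> \<nat>"
  obtains D c where "step_path T x D c"
proof -
  have "\<exists>g D c. step_path T g D c \<and> g 0 = x 0 \<and> (\<forall>t\<in>{0..T}. \<bar>x t - g t\<bar> \<le> 0)"
  proof (rule step_approximation)
    fix v assume v: "v \<in> {0..T}"
    show "\<exists>d>0. 
       (\<forall>s\<in>{0..T}. \<forall>t\<in>{0..T}. v - d < s \<and> s < v \<and> v - d < t \<and> t < v \<longrightarrow> \<bar>x t - x s\<bar> \<le> 0) \<and>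
       (\<forall>t\<in>{0..T}. v \<le> t \<and> t < v + d \<longrightarrow> \<bar>x t - x v\<bar> \<le> 0)"
    proof -
      obtain d where d: "d > 0"
        "\<And>s t. s\<in>{0..T} \<Longrightarrow> t\<in>{0..T} \<Longrightarrow> v - d < s \<Longrightarrow> s < v \<Longrightarrow> v - d < t \<Longrightarrow> t < v \<Longrightarrow> \<bar>x t - x s\<bar> \<le> 1/2"
        "\<And>t. t\<in>{0..T} \<Longrightarrow> v \<le> t \<Longrightarrow> t < v + d \<Longrightarrow> \<bar>x t - x v\<bar> \<le> 1/2"
        using cadlag_path_near[OF x _ v, of "1/2"] by auto
      have "\<bar>x t - x s\<bar> \<le> 0" if "s\<in>{0..T}" "t\<in>{0..T}" "v - d < s" "s < v" "v - d < t" "t < v" for s t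
        by (simp add: Nats_close_eq[OF nat[OF that(2)] nat[OF that(1)] d(2)[OF that]])
      moreover have "\<bar>x t - x v\<bar> \<le> 0" if "t\<in>{0..T}" "v \<le> t" "t < v + d" for t
        by (simp add: Nats_close_eq[OF nat[OF that(1)] nat[OF v] d(3)[OF that]])
      ultimately show ?thesis using d(1) by blast
    qed
  qed (use \<open>0 \<le> T\<close> in auto)
  then obtain g D c where g: "step_path T g D c" "\<And>t. t\<in>{0..T} \<Longrightarrow> x t = g t" by auto
  then have "step_path T x D c"
    unfolding step_path_def
  proof (intro conjI ballI)
    fix t assume t: "t \<in> {0..T}"
    show "x t = x 0 + (\<Sum>u\<in>D \<inter> {..t}. c u)"
      using step_pathD(3)[OF g(1) t] g(2)[OF t] g(2)[of 0] \<open>0 \<le> T\<close> by simp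
  qed (use step_pathD[OF g(1)] in blast)+
  then show ?thesis using that by blast
qed

section \<open>Dyadic Riemann sums\<close>

definition grid :: "real \<Rightarrow> nat \<Rightarrow> nat \<Rightarrow> real" where
  "grid T n k = real k * T / 2 ^ n"

text \<open>
  The index of the dyadic interval \<open>(grid T n k, grid T n (Suc k)]\<close> that contains \<open>u > 0\<close>.
\<close>

definition cell :: "real \<Rightarrow> nat \<Rightarrow> real \<Rightarrow> nat" where
  "cell T n u = nat \<lceil>u * 2 ^ n / T\<rceil> - 1"

definition increment :: "real \<Rightarrow> nat \<Rightarrow> (real \<Rightarrow> real) \<Rightarrow> real \<Rightarrow> nat \<Rightarrow> real" where
  "increment T n x t k = x (min (grid T n (Suc k)) t) - x (min (grid T n k) t)"

definition riemann :: "real \<Rightarrow> nat \<Rightarrow> (real \<Rightarrow> real) \<Rightarrow> (real \<Rightarrow> real) \<Rightarrow> real \<Rightarrow> real" where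
  "riemann T n z x t = (\<Sum>k<2 ^ n. z (grid T n k) * increment T n x t k)"

definition covsum :: "real \<Rightarrow> nat \<Rightarrow> (real \<Rightarrow> real) \<Rightarrow> (real \<Rightarrow> real) \<Rightarrow> real \<Rightarrow> real" where
  "covsum T n x y t = (\<Sum>k<2 ^ n. increment T n x t k * increment T n y t k)"

lemma grid_0 [simp]: "grid T n 0 = 0"
  and grid_end [simp]: "grid T n (2 ^ n) = T"
  by (auto simp: grid_def)

lemma grid_mono: "0 \<le> T \<Longrightarrow> k \<le> l \<Longrightarrow> grid T n k \<le> grid T n l"
  by (auto simp: grid_def intro!: divide_right_mono mult_right_mono)

lemma grid_nonneg: "0 \<le> T \<Longrightarrow> 0 \<le> grid T n k"
  by (auto simp: grid_def)

lemma grid_le: "0 \<le> T \<Longrightarrow> k \<le> 2 ^ n \<Longrightarrow> grid T n k \<le> T"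
  using grid_mono[of T k "2 ^ n" n] by simp

lemma in_cell_iff:
  assumes "0 < T" "0 < u"
  shows "grid T n k < u \<and> u \<le> grid T n (Suc k) \<longleftrightarrow> k = cell T n u"
proof -
  define q where "q = u * 2 ^ n / T"
  have "q > 0" using assms by (auto simp: q_def)
  have "grid T n k < u \<longleftrightarrow> real k < q"
    using assms by (auto simp: grid_def q_def field_simps)
  moreover have "u \<le> grid T n (Suc k) \<longleftrightarrow> q \<le> real (Suc k)"
    using assms unfolding grid_def q_def by (simp add: pos_divide_le_eq pos_le_divide_eq)
  moreover have "real k < q \<and> q \<le> real (Suc k) \<longleftrightarrow> k = nat \<lceil>q\<rceil> - 1"
    using \<open>q > 0\<close> by linarith
  ultimately show ?thesis by (simp add: cell_def q_def)
qed

lemma cell_bounds: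
  assumes "0 < T" "0 < u"
  shows "grid T n (cell T n u) < u" "u \<le> grid T n (Suc (cell T n u))"
  using in_cell_iff[OF assms, of n "cell T n u"] by auto

lemma cell_less:
  assumes "0 < T" "0 < u" "u \<le> T"
  shows "cell T n u < 2 ^ n"
proof (rule ccontr)
  assume "\<not> ?thesis"
  then have "grid T n (2 ^ n) \<le> grid T n (cell T n u)" using assms by (intro grid_mono) auto
  then show False using cell_bounds(1)[OF assms(1,2), of n] assms by simp
qed

lemma grid_step: "grid T n (Suc k) = grid T n k + T / 2 ^ n"
  by (simp add: grid_def field_simps)

lemma mesh_tendsto: "(\<lambda>n. T / 2 ^ n) \<longlonglongrightarrow> (0::real)"
  using LIMSEQ_divide_realpow_zero[of 2 T] by simp

lemma cell_left_tendsto: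
  assumes "0 < T" "0 < u"
  shows "filterlim (\<lambda>n. grid T n (cell T n u)) (at_left u) sequentially"
proof (rule tendsto_imp_filterlim_at_left)
  have "(\<lambda>n. u - T / 2 ^ n) \<longlonglongrightarrow> u - 0" by (intro tendsto_intros mesh_tendsto)
  then have lower: "(\<lambda>n. u - T / 2 ^ n) \<longlonglongrightarrow> u" by simp
  show "(\<lambda>n. grid T n (cell T n u)) \<longlonglongrightarrow> u"
  proof (rule tendsto_sandwich[OF _ _ lower tendsto_const])
    show "\<forall>\<^sub>F n in sequentially. u - T / 2 ^ n \<le> grid T n (cell T n u)"
    proof (rule always_eventually, rule allI)
      fix n show "u - T / 2 ^ n \<le> grid T n (cell T n u)"
        using cell_bounds(2)[OF assms, of n] by (simp add: grid_step)
    qed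
    show "\<forall>\<^sub>F n in sequentially. grid T n (cell T n u) \<le> u"
      using cell_bounds(1)[OF assms] by (intro always_eventually allI less_imp_le)
  qed
  show "\<forall>\<^sub>F n in sequentially. grid T n (cell T n u) < u"
    using cell_bounds(1)[OF assms] by (intro always_eventually allI)
qed

lemma cell_right_tendsto:
  assumes "0 < T" "0 < u"
  shows "(\<lambda>n. grid T n (Suc (cell T n u))) \<longlonglongrightarrow> u"
proof -
  have "(\<lambda>n. grid T n (cell T n u)) \<longlonglongrightarrow> u"
    using cell_left_tendsto[OF assms] by (simp add: filterlim_at)
  then have "(\<lambda>n. grid T n (cell T n u) + T / 2 ^ n) \<longlonglongrightarrow> u + 0"
    by (intro tendsto_intros mesh_tendsto)
  then show ?thesis by (simp add: grid_step)
qed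

lemma left_value_tendsto:
  assumes "cadlag_path T x" "0 < u" "u \<le> T"
  shows "(\<lambda>n. x (grid T n (cell T n u))) \<longlonglongrightarrow> left_lim x u"
  using assms by (intro filterlim_compose[OF cadlag_path_left_lim cell_left_tendsto]) auto

text \<open>
  The endpoints of the cell of \<open>u\<close> approach \<open>u\<close> strictly from the left and weakly from the right,
  which is where the left limit and right continuity enter.
\<close>

lemma increment_at_tendsto:
  assumes x: "cadlag_path T x" and u: "0 < u" "u \<le> t" "t \<le> T"
  shows "(\<lambda>n. increment T n x t (cell T n u)) \<longlonglongrightarrow> jump x u"
proof -
  have T: "0 < T" using u by simp
  define p where "p n = min (grid T n (Suc (cell T n u))) t" for n
  have p: "p n \<ge> u" for n using cell_bounds(2)[OF T u(1)] u by (auto simp: p_def)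
  have plim: "p \<longlonglongrightarrow> u"
  proof -
    have "p \<longlonglongrightarrow> min u t"
      unfolding p_def using cell_right_tendsto[OF T u(1)] by (intro tendsto_min) auto
    then show ?thesis using u by (simp add: min_absorb1)
  qed
  \<comment> \<open>At \<open>u = T\<close> nothing is known to the right of \<open>u\<close>, but there \<open>p n = u\<close>.\<close>
  have "(\<lambda>n. x (p n)) \<longlonglongrightarrow> x u"
  proof (cases "u < T")
    case True
    then have "(x \<longlongrightarrow> x u) (at_right u)" using x u by (auto simp: cadlag_path_def)
    then have "(x \<longlongrightarrow> x u) (at u within {u..})"
      by (metis at_within_Ici_at_right)
    then have "continuous (at u within {u..}) x" by (simp add: continuous_within)
    then show ?thesis
      using p plim by (auto simp: continuous_within_sequentially comp_def)
  next
    case False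
    then have "p n = u" for n using p[of n] u by (auto simp: p_def)
    then show ?thesis by simp
  qed
  moreover have "(\<lambda>n. x (min (grid T n (cell T n u)) t)) \<longlonglongrightarrow> left_lim x u"
    using left_value_tendsto[OF x u(1)] u cell_bounds(1)[OF T u(1)]
    by (simp add: min_absorb1 less_imp_le order_trans[OF less_imp_le u(2)])
  ultimately show ?thesis
    unfolding increment_def jump_def p_def by (intro tendsto_diff)
qed

lemma increment_step_path:
  assumes x: "step_path T x D c" and t: "t \<in> {0..T}" and k: "k < 2 ^ n"
  shows "increment T n x t k = (\<Sum>u\<in>D \<inter> {..t}. of_bool (k = cell T n u) * c u)"
proof (cases "T = 0")
  case True
  then have "D = {}" using step_pathD(2)[OF x] by auto
  then show ?thesis using True t by (simp add: increment_def grid_def)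
next
  case False
  then have T: "0 < T" using t by auto
  define a b where "a = min (grid T n k) t" and "b = min (grid T n (Suc k)) t"
  have ab: "0 \<le> a" "a \<le> b" "b \<le> t" "b \<in> {0..T}" "a \<in> {0..T}"
    using t T grid_mono[of T k "Suc k" n] grid_nonneg[of T n k] grid_nonneg[of T n "Suc k"]
    by (auto simp: a_def b_def)
  have fin: "finite D" using step_pathD(1)[OF x] .
  have "increment T n x t k = (\<Sum>u\<in>D \<inter> {..b}. c u) - (\<Sum>u\<in>D \<inter> {..a}. c u)"
    unfolding increment_def a_def[symmetric] b_def[symmetric]
      step_pathD(3)[OF x ab(4)] step_pathD(3)[OF x ab(5)] by simp
  also have "\<dots> = (\<Sum>u\<in>D \<inter> {..b} - D \<inter> {..a}. c u)"
    using fin ab by (subst sum_diff) auto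
  also have "\<dots> = (\<Sum>u\<in>D \<inter> {..t}. of_bool (k = cell T n u) * c u)"
  proof (rule sum.mono_neutral_cong_left)
    have pos: "u > 0" if "u \<in> D" for u using step_pathD(2)[OF x] that by auto
    have iff: "k = cell T n u \<longleftrightarrow> a < u \<and> u \<le> b" if "u \<in> D" "u \<le> t" for u
      using in_cell_iff[OF T pos[OF that(1)], of n k] that
      by (auto simp: a_def b_def)
    show "\<forall>i\<in>D \<inter> {..t} - (D \<inter> {..b} - D \<inter> {..a}). of_bool (k = cell T n i) * c i = 0"
      using iff by auto
    show "\<And>u. u \<in> D \<inter> {..b} - D \<inter> {..a} \<Longrightarrow> c u = of_bool (k = cell T n u) * c u"
      using iff ab by auto
  qed (use fin ab in auto)
  finally show ?thesis .
qed

text \<open>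
  Each jump is seen by exactly one dyadic interval. The weights \<open>w\<close> are arbitrary because the
  identity is applied both to Riemann sums (\<open>w\<close> the values of the integrand) and to covariation sums
  (\<open>w\<close> the increments of the other path).
\<close>

lemma sum_increment_step_path:
  assumes x: "step_path T x D c" and t: "t \<in> {0..T}"
  shows "(\<Sum>k<2 ^ n. w k * increment T n x t k) = (\<Sum>u\<in>D \<inter> {..t}. c u * w (cell T n u))"
proof -
  have "(\<Sum>k<2 ^ n. w k * increment T n x t k)
    = (\<Sum>k<2 ^ n. \<Sum>u\<in>D \<inter> {..t}. w k * (of_bool (k = cell T n u) * c u))"
    by (intro sum.cong refl) (simp add: increment_step_path[OF x t] sum_distrib_left)
  also have "\<dots> = (\<Sum>u\<in>D \<inter> {..t}. \<Sum>k<2 ^ n. w k * (of_bool (k = cell T n u) * c u))"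
    by (rule sum.swap)
  also have "\<dots> = (\<Sum>u\<in>D \<inter> {..t}. c u * w (cell T n u))"
  proof (intro sum.cong refl)
    fix u assume u: "u \<in> D \<inter> {..t}"
    then have "u \<in> {0<..T}" using step_pathD(2)[OF x] by auto
    then have "cell T n u < 2 ^ n" by (intro cell_less) auto
    then have "(\<Sum>k<2 ^ n. w k * (of_bool (k = cell T n u) * c u))
      = (\<Sum>k\<in>{cell T n u}. w k * (of_bool (k = cell T n u) * c u))"
      by (intro sum.mono_neutral_right) auto
    then show "(\<Sum>k<2 ^ n. w k * (of_bool (k = cell T n u) * c u)) = c u * w (cell T n u)"
      by simp
  qed
  finally show ?thesis .
qed

lemma sum_increment:
  assumes "t \<in> {0..T}"
  shows "(\<Sum>k<2 ^ n. increment T n x t k) = x t - x 0"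
proof -
  have "(\<Sum>k<2 ^ n. increment T n x t k) = x (min (grid T n (2 ^ n)) t) - x (min (grid T n 0) t)"
    unfolding increment_def by (rule sum_lessThan_telescope)
  then show ?thesis using assms by (simp add: min_absorb1 min_absorb2)
qed

lemma riemann_step_path_tendsto:
  assumes x: "step_path T x D c" and z: "cadlag_path T z" and t: "t \<in> {0..T}"
  shows "(\<lambda>n. riemann T n z x t) \<longlonglongrightarrow> (\<Sum>u\<in>D \<inter> {..t}. left_lim z u * jump x u)"
proof -
  have "(\<lambda>n. \<Sum>u\<in>D \<inter> {..t}. c u * z (grid T n (cell T n u)))
    \<longlonglongrightarrow> (\<Sum>u\<in>D \<inter> {..t}. c u * left_lim z u)"
    using step_pathD(2)[OF x]
    by (intro tendsto_sum tendsto_mult tendsto_const left_value_tendsto[OF z]) auto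
  also have "(\<Sum>u\<in>D \<inter> {..t}. c u * left_lim z u) = (\<Sum>u\<in>D \<inter> {..t}. left_lim z u * jump x u)"
    using step_pathD(2)[OF x] step_path_jump[OF x] by (intro sum.cong) auto
  finally show ?thesis
    by (simp add: riemann_def sum_increment_step_path[OF x t])
qed

lemma covsum_commute: "covsum T n x y t = covsum T n y x t"
  by (simp add: covsum_def mult.commute)

lemma covsum_step_path_tendsto:
  assumes y: "step_path T y D c" and x: "cadlag_path T x" and t: "t \<in> {0..T}"
  shows "(\<lambda>n. covsum T n x y t) \<longlonglongrightarrow> (\<Sum>u\<in>D \<inter> {..t}. jump x u * jump y u)"
proof -
  have "(\<lambda>n. \<Sum>u\<in>D \<inter> {..t}. c u * increment T n x t (cell T n u))
    \<longlonglongrightarrow> (\<Sum>u\<in>D \<inter> {..t}. c u * jump x u)"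
    using step_pathD(2)[OF y] t
    by (intro tendsto_sum tendsto_mult tendsto_const increment_at_tendsto[OF x]) auto
  also have "(\<Sum>u\<in>D \<inter> {..t}. c u * jump x u) = (\<Sum>u\<in>D \<inter> {..t}. jump x u * jump y u)"
    using step_pathD(2)[OF y] step_path_jump[OF y] by (intro sum.cong) auto
  finally show ?thesis
    by (simp add: covsum_def sum_increment_step_path[OF y t])
qed

lemma continuous_path_left_lim:
  assumes "continuous_on {0..T} x" "0 < u" "u \<le> T"
  shows "(x \<longlongrightarrow> x u) (at_left u)"
proof -
  have "(x \<longlongrightarrow> x u) (at u within {0..T})"
    using assms by (auto simp: continuous_on_def)
  then have "(x \<longlongrightarrow> x u) (at u within {0..u})"
    by (rule tendsto_within_subset) (use assms in auto)
  then show ?thesis using assms by (simp add: at_within_Icc_at_left)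
qed

lemma continuous_path_jump:
  assumes "continuous_on {0..T} x" "0 < u" "u \<le> T"
  shows "jump x u = 0"
  using left_lim_eqI[OF continuous_path_left_lim[OF assms]] by (simp add: jump_def)

lemma continuous_path_cadlag:
  assumes x: "continuous_on {0..T} x"
  shows "cadlag_path T x"
  unfolding cadlag_path_def
proof (intro conjI ballI)
  fix t assume t: "t \<in> {0..<T}"
  have "(x \<longlongrightarrow> x t) (at t within {0..T})"
    using t x by (auto simp: continuous_on_def)
  then have "(x \<longlongrightarrow> x t) (at t within {t..T})"
    by (rule tendsto_within_subset) (use t in auto)
  then show "(x \<longlongrightarrow> x t) (at_right t)" using t by (simp add: at_within_Icc_at_right)
next
  fix t assume "t \<in> {0<..T}"
  then show "\<exists>l. (x \<longlongrightarrow> l) (at_left t)"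
    using continuous_path_left_lim[OF x] by auto
qed

lemma increment_mono:
  assumes "mono_on {0..T} y" "t \<in> {0..T}"
  shows "0 \<le> increment T n y t k"
  using assms grid_mono[of T k "Suc k" n] grid_nonneg[of T n k]
  unfolding increment_def by (auto intro!: mono_onD[OF assms(1)] min.mono)

text \<open>
  If \<open>x\<close> is a step path, the covariation sums tend to \<open>\<Sum>\<Delta>x \<Delta>y\<close>, which vanishes because \<open>y\<close> is
  continuous. A cadlag path is uniformly within \<open>d\<close> of a step path, and the error is bounded by
  \<open>2 d\<close> times the total variation \<open>y t - y 0\<close>.
\<close>

lemma covsum_continuous_mono_tendsto:
  assumes y: "continuous_on {0..T} y" "mono_on {0..T} y" and x: "cadlag_path T x" and t: "t \<in> {0..T}"
  shows "(\<lambda>n. covsum T n x y t) \<longlonglongrightarrow> 0"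
proof (rule LIMSEQ_I)
  fix e :: real assume e: "0 < e"
  \<comment> \<open>The summand \<open>1\<close> keeps \<open>V\<close> positive when \<open>y\<close> is constant.\<close>
  define V where "V = y t - y 0 + 1"
  have V: "V > 0" using mono_onD[OF y(2), of 0 t] t by (auto simp: V_def)
  define d where "d = e / (4 * V)"
  have d: "d > 0" using e V by (simp add: d_def)
  have T: "0 \<le> T" using t by auto
  obtain g D c where g: "step_path T g D c" "\<And>t. t \<in> {0..T} \<Longrightarrow> \<bar>x t - g t\<bar> \<le> d"
    using cadlag_path_approx_step[OF x T d] by auto
  have "(\<lambda>n. covsum T n y g t) \<longlonglongrightarrow> (\<Sum>u\<in>D \<inter> {..t}. jump y u * jump g u)"
    by (rule covsum_step_path_tendsto[OF g(1) continuous_path_cadlag[OF y(1)] t])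
  also have "(\<Sum>u\<in>D \<inter> {..t}. jump y u * jump g u) = 0"
    using step_pathD(2)[OF g(1)] continuous_path_jump[OF y(1)] by (intro sum.neutral) auto
  finally have "\<forall>\<^sub>F n in sequentially. dist (covsum T n y g t) 0 < e / 2"
    using e by (intro tendstoD) auto
  then obtain n0 where n0: "\<And>n. n \<ge> n0 \<Longrightarrow> \<bar>covsum T n g y t\<bar> < e / 2"
    by (auto simp: eventually_sequentially covsum_commute[of T _ g y])
  have "norm (covsum T n x y t - 0) < e" if "n \<ge> n0" for n
  proof -
    have inc: "\<bar>increment T n x t k - increment T n g t k\<bar> \<le> 2 * d" for k
    proof -
      have "min (grid T n j) t \<in> {0..T}" for j
        using t grid_nonneg[OF T, of n j] by auto
      from g(2)[OF this[of k]] g(2)[OF this[of "Suc k"]] show ?thesis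
        unfolding increment_def by arith
    qed
    have "covsum T n x y t - covsum T n g y t
      = (\<Sum>k<2^n. (increment T n x t k - increment T n g t k) * increment T n y t k)"
      by (simp add: covsum_def left_diff_distrib sum_subtractf)
    also have "\<bar>\<dots>\<bar> \<le> (\<Sum>k<2^n. 2 * d * increment T n y t k)"
    proof (rule order_trans[OF sum_abs], rule sum_mono)
      fix k show "\<bar>(increment T n x t k - increment T n g t k) * increment T n y t k\<bar>
        \<le> 2 * d * increment T n y t k"
        using inc[of k] increment_mono[OF y(2) t, of n k]
        by (simp add: abs_mult mult_right_mono)
    qed
    also have "\<dots> = 2 * d * (y t - y 0)"
      by (simp add: sum_distrib_left[symmetric] sum_increment[OF t])
    also have "\<dots> < 2 * d * V" using d by (simp add: V_def)
    also have "\<dots> = e / 2" using V by (simp add: d_def)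
    finally have "\<bar>covsum T n x y t - covsum T n g y t\<bar> < e / 2" .
    then show ?thesis using n0[OF that] unfolding real_norm_def by arith
  qed
  then show "\<exists>n0. \<forall>n\<ge>n0. norm (covsum T n x y t - 0) < e" by blast
qed

text \<open>
  A term with \<open>grid T n k > t\<close> has increment zero, so its integrand may be evaluated at \<open>t\<close>; in this
  form the product rule for increments holds term by term.
\<close>

lemma riemann_alt:
  assumes "0 \<le> T"
  shows "riemann T n z x t = (\<Sum>k<2 ^ n. z (min (grid T n k) t) * increment T n x t k)"
  unfolding riemann_def
proof (intro sum.cong refl)
  fix k
  show "z (grid T n k) * increment T n x t k = z (min (grid T n k) t) * increment T n x t k"
    using grid_mono[OF assms, of k "Suc k" n]
    by (cases "grid T n k \<le> t") (auto simp: increment_def min_def)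
qed

lemma covsum_eq_riemann:
  assumes "t \<in> {0..T}"
  shows "covsum T n x y t = x t * y t - x 0 * y 0 - riemann T n x y t - riemann T n y x t"
proof -
  have T: "0 \<le> T" using assms by auto
  have "covsum T n x y t + riemann T n x y t + riemann T n y x t
    = (\<Sum>k<2 ^ n. increment T n (\<lambda>t. x t * y t) t k)"
    unfolding covsum_def riemann_alt[OF T] sum.distrib[symmetric]
    by (intro sum.cong refl) (simp add: increment_def algebra_simps)
  then show ?thesis using sum_increment[OF assms, of n "\<lambda>t. x t * y t"] by simp
qed

lemma continuous_on_covsum:
  assumes "continuous_on {0..T} x" "continuous_on {0..T} y"
  shows "continuous_on {0..T} (covsum T n x y)"
proof (cases "0 \<le> T")
  case True
  have c: "continuous_on {0..T} (\<lambda>t. z (min (grid T n k) t))" if "continuous_on {0..T} z" for z k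
    by (rule continuous_on_compose2[OF that])
       (auto intro!: continuous_intros simp: grid_nonneg[OF True])
  show ?thesis
    unfolding covsum_def increment_def by (intro continuous_intros c assms)
qed auto

text \<open>
  Passing from \<open>s\<close> to \<open>t\<close> adds squares and only replaces the square on the interval that contains
  \<open>s\<close>, an error that vanishes in the limit since \<open>x\<close> is continuous.
\<close>

lemma covsum_self_limit_mono:
  assumes x: "continuous_on {0..T} x" 
    and q: "\<And>t. t \<in> {0..T} \<Longrightarrow> (\<lambda>n. covsum T (r n) x x t) \<longlonglongrightarrow> q t" and r: "strict_mono r"
  shows "mono_on {0..T} q"
proof (rule mono_onI)
  fix s t assume st: "s \<in> {0..T}" "t \<in> {0..T}" "s \<le> t"
  show "q s \<le> q t"
  proof (cases "s = 0")
    case True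
    have "covsum T n x x s = 0" for n
      unfolding covsum_def using st True
      by (intro sum.neutral) (auto simp: increment_def min_absorb2 grid_nonneg)
    then have "q s = 0" using LIMSEQ_unique[OF q[OF st(1)]] by simp
    moreover have "0 \<le> q t"
      by (rule LIMSEQ_le_const[OF q[OF st(2)]]) (auto simp: covsum_def sum_nonneg)
    ultimately show ?thesis by simp
  next
    case False
    then have s: "0 < s" "s \<le> T" and T: "0 < T" using st by auto
    have bound: "covsum T n x x s \<le> covsum T n x x t + (increment T n x s (cell T n s))\<^sup>2" for n
    proof -
      have "increment T n x s k * increment T n x s k
        \<le> increment T n x t k * increment T n x t k + of_bool (k = cell T n s) * (increment T n x s k)\<^sup>2" for k
      proof -
        consider "k = cell T n s" | "s \<le> grid T n k" | "grid T n (Suc k) < s" "grid T n k < s"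
          using in_cell_iff[OF T s(1), of n k] grid_mono[of T k "Suc k" n] T by force
        then show ?thesis
        proof cases
          case 1
          then show ?thesis by (simp add: power2_eq_square)
        next
          case 2
          then have "increment T n x s k = 0"
            using grid_mono[of T k "Suc k" n] T by (simp add: increment_def min_absorb2)
          then show ?thesis by simp
        next
          case 3
          then have "increment T n x s k = increment T n x t k"
            using st by (simp add: increment_def min_absorb1)
          then show ?thesis by simp
        qed
      qed
      then have "covsum T n x x s \<le> (\<Sum>k<2^n. increment T n x t k * increment T n x t k 
        + of_bool (k = cell T n s) * (increment T n x s k)\<^sup>2)"
        unfolding covsum_def by (intro sum_mono)
      also have "\<dots> = covsum T n x x t + (\<Sum>k<2^n. of_bool (k = cell T n s) * (increment T n x s k)\<^sup>2)"
        by (simp add: covsum_def sum.distrib)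
      also have "(\<Sum>k<2^n. of_bool (k = cell T n s) * (increment T n x s k)\<^sup>2)
        = (\<Sum>k\<in>{cell T n s}. of_bool (k = cell T n s) * (increment T n x s k)\<^sup>2)"
        using cell_less[OF T s, of n] by (intro sum.mono_neutral_right) auto
      finally show ?thesis by simp
    qed
    have "(\<lambda>n. increment T n x s (cell T n s)) \<longlonglongrightarrow> 0"
      using increment_at_tendsto[OF continuous_path_cadlag[OF x] s(1) order_refl s(2)]
        continuous_path_jump[OF x s] by simp
    then have "(\<lambda>n. increment T (r n) x s (cell T (r n) s)) \<longlonglongrightarrow> 0"
      using LIMSEQ_subseq_LIMSEQ[OF _ r, of "\<lambda>n. increment T n x s (cell T n s)" 0]
      by (simp add: comp_def)
    then have "(\<lambda>n. covsum T (r n) x x t + (increment T (r n) x s (cell T (r n) s))\<^sup>2) \<longlonglongrightarrow> q t + 0\<^sup>2"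
      by (intro tendsto_intros q st)
    then have "q s \<le> q t + 0\<^sup>2"
      by (rule LIMSEQ_le[OF q[OF st(1)]]) (use bound in blast)
    then show ?thesis by simp
  qed
qed

section \<open>Ito integrals as limits of dyadic Riemann sums\<close>

lemma indistinguishableD:
  "indistinguishable P T X Y \<Longrightarrow> AE \<omega> in P. \<forall>t\<in>{0..T}. X t \<omega> = Y t \<omega>"
  by (simp add: indistinguishable_def)

text \<open>
  The exceptional sets need not be measurable. They are covered by measurable sets of the same
  outer measure, chosen summable along a subsequence, and the Borel--Cantelli lemma applies to
  the covers. The statement starts from an arbitrary subsequence \<open>r\<close> so that it can be used for
  several limits in succession.
\<close>

lemma (in finite_measure) ucp_limit_subseq_uniform:
  assumes ucp: "ucp_limit M T Z Z'" and r: "strict_mono r"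
  obtains s :: "nat \<Rightarrow> nat" where "strict_mono s"
    "AE \<omega> in M. uniform_limit {0..T} (\<lambda>n t. Z (r (s n)) t \<omega>) (\<lambda>t. Z' t \<omega>) sequentially"
proof -
  define bad where "bad n e = {\<omega>\<in>space M. \<exists>t\<in>{0..T}. e < \<bar>Z n t \<omega> - Z' t \<omega>\<bar>}" for n e
  have ev: "\<forall>\<^sub>F n in sequentially. outer_measure_of M (bad (r n) (1 / Suc k)) < ennreal ((1/2) ^ k)" for k
  proof -
    have "(\<lambda>n. outer_measure_of M (bad n (1 / Suc k))) \<longlonglongrightarrow> 0"
      using ucp unfolding ucp_limit_def bad_def by simp
    then have "\<forall>\<^sub>F n in sequentially. outer_measure_of M (bad n (1 / Suc k)) < ennreal ((1/2) ^ k)"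
      by (rule order_tendstoD) auto
    then show ?thesis
      by (rule eventually_compose_filterlim) (rule filterlim_subseq[OF r])
  qed
  have "\<exists>s. \<forall>k. outer_measure_of M (bad (r (s k)) (1 / Suc k)) < ennreal ((1/2) ^ k) \<and> s k < s (Suc k)"
  proof (rule dependent_nat_choice)
    show "\<exists>x. outer_measure_of M (bad (r x) (1 / real (Suc 0))) < ennreal ((1 / 2) ^ 0)"
      using ev[of 0] by (auto simp: eventually_sequentially)
  next
    fix x k
    show "\<exists>y. outer_measure_of M (bad (r y) (1 / real (Suc (Suc k)))) < ennreal ((1 / 2) ^ Suc k) \<and> x < y"
      using eventually_happens'[OF _ eventually_conj[OF ev[of "Suc k"] eventually_gt_at_top[of x]]]
      by (auto simp del: power_Suc)
  qed
  then obtain s where s: "\<And>k. outer_measure_of M (bad (r (s k)) (1 / Suc k)) < ennreal ((1/2) ^ k)"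
    and "strict_mono s"
    by (auto simp: strict_mono_Suc_iff)
  have "\<exists>B\<in>sets M. bad (r (s k)) (1 / Suc k) \<subseteq> B \<and> 
      outer_measure_of M (bad (r (s k)) (1 / Suc k)) = emeasure M B" for k
    by (rule outer_measure_of_attain) (auto simp: bad_def)
  then obtain B where B: "\<And>k. B k \<in> sets M" "\<And>k. bad (r (s k)) (1 / Suc k) \<subseteq> B k"
    "\<And>k. outer_measure_of M (bad (r (s k)) (1 / Suc k)) = emeasure M (B k)"
    by metis
  have meas: "measure M (B k) \<le> (1/2) ^ k" for k
    unfolding measure_def using s[of k] unfolding B(3) by (intro enn2real_leI) auto
  have "AE \<omega> in M. \<forall>\<^sub>F k in sequentially. \<omega> \<in> space M - B k"
  proof (rule borel_cantelli_AE1[OF B(1)])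
    show "summable (\<lambda>k. measure M (B k))"
      by (rule summable_comparison_test'[of "\<lambda>k. (1/2) ^ k" 0]) (use meas in auto)
  qed (simp add: emeasure_eq_measure)
  then have "AE \<omega> in M. uniform_limit {0..T} (\<lambda>n t. Z (r (s n)) t \<omega>) (\<lambda>t. Z' t \<omega>) sequentially"
  proof (eventually_elim, intro uniform_limitI)
    fix \<omega> and e :: real
    assume *: "\<forall>\<^sub>F k in sequentially. \<omega> \<in> space M - B k" and "0 < e"
    have "\<forall>\<^sub>F k in sequentially. 1 / Suc k < e"
      using order_tendstoD(2)[OF LIMSEQ_inverse_real_of_nat \<open>0 < e\<close>] by (simp add: inverse_eq_divide)
    with * show "\<forall>\<^sub>F n in sequentially. \<forall>t\<in>{0..T}. dist (Z (r (s n)) t \<omega>) (Z' t \<omega>) < e"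
    proof eventually_elim
      case (elim k)
      then have "\<omega> \<notin> bad (r (s k)) (1 / Suc k)" "\<omega> \<in> space M" using B(2)[of k] by auto
      then have "\<bar>Z (r (s k)) t \<omega> - Z' t \<omega>\<bar> \<le> 1 / Suc k" if "t \<in> {0..T}" for t
        using that by (auto simp: bad_def not_less)
      then show ?case using elim by (fastforce simp: dist_real_def)
    qed
  qed
  then show ?thesis using that \<open>strict_mono s\<close> by blast
qed

definition dyadic_elementary :: "real \<Rightarrow> 'a process \<Rightarrow> nat \<Rightarrow> 'a elementary" where
  "dyadic_elementary T Z n = map (\<lambda>k. (grid T n k, grid T n (Suc k), Z (grid T n k))) [0..<2 ^ n]"

lemma elem_integral_dyadic:
  "elem_integral (dyadic_elementary T Z n) X t \<omega> = riemann T n (\<lambda>t. Z t \<omega>) (\<lambda>t. X t \<omega>) t"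
  by (simp add: elem_integral_def dyadic_elementary_def riemann_def increment_def comp_def
      interv_sum_list_conv_sum_set_nat atLeast0LessThan)

lemma elem_process_dyadic:
  assumes t: "0 < t" "t \<le> T"
  shows "elem_process (dyadic_elementary T Z n) t \<omega> = Z (grid T n (cell T n t)) \<omega>"
proof -
  have T: "0 < T" using t by simp
  have "elem_process (dyadic_elementary T Z n) t \<omega> 
    = (\<Sum>k<2 ^ n. Z (grid T n k) \<omega> * indicator {grid T n k<..grid T n (Suc k)} t)"
    by (simp add: elem_process_def dyadic_elementary_def comp_def
      interv_sum_list_conv_sum_set_nat atLeast0LessThan)
  also have "\<dots> = (\<Sum>k<2 ^ n. Z (grid T n k) \<omega> * of_bool (k = cell T n t))"
    using in_cell_iff[OF T t(1), of n] by (intro sum.cong) (auto simp: indicator_def)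
  also have "\<dots> = (\<Sum>k\<in>{cell T n t}. Z (grid T n k) \<omega> * of_bool (k = cell T n t))"
    using cell_less[OF T t, of n] by (intro sum.mono_neutral_right) auto
  finally show ?thesis by simp
qed

text \<open>
  The left-endpoint dyadic discretizations of \<open>Z\<close> converge pointwise to the left limits of \<open>Z\<close> and are
  bounded by a bound of the path, hence they are admissible in the definition of the integral.
\<close>

lemma ito_integral_ucp_riemann:
  assumes ito: "ito_integral P F T Z X I" and T: "0 < T"
  shows "ucp_limit P T (\<lambda>n t \<omega>. riemann T n (\<lambda>t. Z t \<omega>) (\<lambda>t. X t \<omega>) t) I"
proof -
  have Z: "adapted F T Z" "AE \<omega> in P. cadlag_path T (\<lambda>t. Z t \<omega>)"
    using ito by (auto simp: ito_integral_def cadlag_process_def)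
  have "elementary F T (dyadic_elementary T Z n)" for n
    using Z(1) T grid_nonneg[of T n] grid_mono[of T _ _ n] grid_le[of T _ n]
    by (auto simp: elementary_def dyadic_elementary_def adapted_def Suc_leI less_imp_le)
  moreover have "AE \<omega> in P. \<forall>t\<in>{0<..T}. 
      (\<lambda>n. elem_process (dyadic_elementary T Z n) t \<omega>) \<longlonglongrightarrow> left_lim (\<lambda>t. Z t \<omega>) t"
    using Z(2)
  proof (eventually_elim, intro ballI)
    fix \<omega> t assume "cadlag_path T (\<lambda>t. Z t \<omega>)" "t \<in> {0<..T}"
    then show "(\<lambda>n. elem_process (dyadic_elementary T Z n) t \<omega>) \<longlonglongrightarrow> left_lim (\<lambda>t. Z t \<omega>) t"
      using left_value_tendsto[of T "\<lambda>t. Z t \<omega>" t] by (simp add: elem_process_dyadic)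
  qed
  moreover have "AE \<omega> in P. \<exists>C. \<forall>n. \<forall>t\<in>{0<..T}. \<bar>elem_process (dyadic_elementary T Z n) t \<omega>\<bar> \<le> C"
    using Z(2)
  proof eventually_elim
    case (elim \<omega>)
    obtain C where C: "\<And>t. t \<in> {0..T} \<Longrightarrow> \<bar>Z t \<omega>\<bar> \<le> C"
      using cadlag_path_bounded[OF elim] T by auto
    have "\<bar>elem_process (dyadic_elementary T Z n) t \<omega>\<bar> \<le> C" if "t \<in> {0<..T}" for n t
    proof -
      have "grid T n (cell T n t) \<in> {0..T}"
        using that T cell_bounds(1)[OF T, of t n] grid_nonneg[of T n "cell T n t"] by auto
      then show ?thesis using that C by (simp add: elem_process_dyadic)
    qed
    then show ?case by blast
  qed
  ultimately have "ucp_limit P T (\<lambda>n. elem_integral (dyadic_elementary T Z n) X) I"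
    using ito unfolding ito_integral_def by blast
  then show ?thesis by (simp add: elem_integral_dyadic fun_eq_iff[abs_def] ucp_limit_def)
qed

context filtered_prob_space
begin

lemma ito_integral_riemann:
  fixes r :: "nat \<Rightarrow> nat"
  assumes "ito_integral P F T Z X I" "0 < T" "strict_mono r"
  obtains s where "strict_mono s"
    "AE \<omega> in P. uniform_limit {0..T} 
       (\<lambda>n. riemann T (r (s n)) (\<lambda>t. Z t \<omega>) (\<lambda>t. X t \<omega>)) (\<lambda>t. I t \<omega>) sequentially"
  using ucp_limit_subseq_uniform[OF ito_integral_ucp_riemann[OF assms(1,2)] assms(3)] by blast

text \<open>
  Identifies an Ito integral by a deterministic computation on almost every path.
\<close>

lemma ito_integral_pathwise:
  assumes "ito_integral P F T Z X I" "0 < T"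
    and R: "AE \<omega> in P. \<forall>t\<in>{0..T}. (\<lambda>n. riemann T n (\<lambda>t. Z t \<omega>) (\<lambda>t. X t \<omega>) t) \<longlonglongrightarrow> R t \<omega>"
  shows "indistinguishable P T I R"
proof -
  obtain s where s: "strict_mono s"
    "AE \<omega> in P. uniform_limit {0..T} 
       (\<lambda>n. riemann T (s n) (\<lambda>t. Z t \<omega>) (\<lambda>t. X t \<omega>)) (\<lambda>t. I t \<omega>) sequentially"
    using ito_integral_riemann[OF assms(1,2), of "\<lambda>n. n"] by (auto simp: strict_mono_def)
  show ?thesis
    unfolding indistinguishable_def using s(2) R
  proof (eventually_elim, intro ballI)
    fix \<omega> t assume t: "t \<in> {0..T}" and
      u: "uniform_limit {0..T} (\<lambda>n. riemann T (s n) (\<lambda>t. Z t \<omega>) (\<lambda>t. X t \<omega>)) (\<lambda>t. I t \<omega>) sequentially"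
      and R: "\<forall>t\<in>{0..T}. (\<lambda>n. riemann T n (\<lambda>t. Z t \<omega>) (\<lambda>t. X t \<omega>) t) \<longlonglongrightarrow> R t \<omega>"
    have "(\<lambda>n. riemann T (s n) (\<lambda>t. Z t \<omega>) (\<lambda>t. X t \<omega>) t) \<longlonglongrightarrow> R t \<omega>"
      using LIMSEQ_subseq_LIMSEQ[OF R[rule_format, OF t] s(1)] by (simp add: comp_def)
    then show "I t \<omega> = R t \<omega>"
      using tendsto_uniform_limitI[OF u t] LIMSEQ_unique by blast
  qed
qed

text \<open>
  The Riemann sums depend only on the paths of the integrator on \<open>[0,T]\<close>, so both integrals are
  limits of the same sums along a common subsequence.
\<close>

lemma ito_integral_unique:
  assumes I: "ito_integral P F T Z X I" and I': "ito_integral P F T Z X' I'" and T: "0 < T"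
    and X: "indistinguishable P T X X'"
  shows "indistinguishable P T I I'"
proof -
  obtain s where s: "strict_mono s"
    "AE \<omega> in P. uniform_limit {0..T} 
       (\<lambda>n. riemann T (s n) (\<lambda>t. Z t \<omega>) (\<lambda>t. X t \<omega>)) (\<lambda>t. I t \<omega>) sequentially"
    using ito_integral_riemann[OF I T, of "\<lambda>n. n"] by (auto simp: strict_mono_def)
  obtain s' where s': "strict_mono s'"
    "AE \<omega> in P. uniform_limit {0..T} 
       (\<lambda>n. riemann T (s (s' n)) (\<lambda>t. Z t \<omega>) (\<lambda>t. X' t \<omega>)) (\<lambda>t. I' t \<omega>) sequentially"
    using ito_integral_riemann[OF I' T s(1)] by blast
  show ?thesis
    unfolding indistinguishable_def using s(2) s'(2) indistinguishableD[OF X]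
  proof (eventually_elim, intro ballI)
    fix \<omega> t assume t: "t \<in> {0..T}" and
      u: "uniform_limit {0..T} (\<lambda>n. riemann T (s n) (\<lambda>t. Z t \<omega>) (\<lambda>t. X t \<omega>)) (\<lambda>t. I t \<omega>) sequentially" and
      u': "uniform_limit {0..T} (\<lambda>n. riemann T (s (s' n)) (\<lambda>t. Z t \<omega>) (\<lambda>t. X' t \<omega>)) (\<lambda>t. I' t \<omega>) sequentially" and
      X: "\<forall>t\<in>{0..T}. X t \<omega> = X' t \<omega>"
    have "riemann T n (\<lambda>t. Z t \<omega>) (\<lambda>t. X t \<omega>) t = riemann T n (\<lambda>t. Z t \<omega>) (\<lambda>t. X' t \<omega>) t" for n
      unfolding riemann_def increment_def using X t grid_nonneg[of T n] T
      by (intro sum.cong refl arg_cong2[where f="(*)"] arg_cong2[where f="(-)"]) (auto simp: min_def)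
    then have "(\<lambda>n. riemann T (s (s' n)) (\<lambda>t. Z t \<omega>) (\<lambda>t. X t \<omega>) t) \<longlonglongrightarrow> I' t \<omega>"
      using tendsto_uniform_limitI[OF u' t] by simp
    moreover have "(\<lambda>n. riemann T (s (s' n)) (\<lambda>t. Z t \<omega>) (\<lambda>t. X t \<omega>) t) \<longlonglongrightarrow> I t \<omega>"
      using LIMSEQ_subseq_LIMSEQ[OF tendsto_uniform_limitI[OF u t] s'(1)] by (simp add: comp_def)
    ultimately show "I t \<omega> = I' t \<omega>" using LIMSEQ_unique by blast
  qed
qed

lemma ito_integral_null:
  assumes I: "ito_integral P F T Z X I" and T: "0 < T"
    and X: "indistinguishable P T X (\<lambda>t \<omega>. 0)"
  shows "indistinguishable P T I (\<lambda>t \<omega>. 0)"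
proof (rule ito_integral_pathwise[OF I T])
  show "AE \<omega> in P. \<forall>t\<in>{0..T}. (\<lambda>n. riemann T n (\<lambda>t. Z t \<omega>) (\<lambda>t. X t \<omega>) t) \<longlonglongrightarrow> 0"
    using indistinguishableD[OF X]
  proof (eventually_elim, intro ballI)
    fix \<omega> t assume t: "t \<in> {0..T}" and X: "\<forall>t\<in>{0..T}. X t \<omega> = 0"
    have "riemann T n (\<lambda>t. Z t \<omega>) (\<lambda>t. X t \<omega>) t = 0" for n
      unfolding riemann_def increment_def using X t grid_nonneg[of T n] T
      by (intro sum.neutral) (auto simp: min_def)
    then show "(\<lambda>n. riemann T n (\<lambda>t. Z t \<omega>) (\<lambda>t. X t \<omega>) t) \<longlonglongrightarrow> 0" by simp
  qed
qed

section \<open>Quadratic covariation\<close>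

lemma quad_covariation_commute:
  assumes "quad_covariation P F T X Y Q"
  shows "quad_covariation P F T Y X Q"
proof -
  obtain I I' where I: "ito_integral P F T X Y I" "ito_integral P F T Y X I'"
    "indistinguishable P T Q (\<lambda>t \<omega>. X t \<omega> * Y t \<omega> - X 0 \<omega> * Y 0 \<omega> - I t \<omega> - I' t \<omega>)"
    "cadlag_process P F T Q"
    using assms by (auto simp: quad_covariation_def)
  have "indistinguishable P T Q (\<lambda>t \<omega>. Y t \<omega> * X t \<omega> - Y 0 \<omega> * X 0 \<omega> - I' t \<omega> - I t \<omega>)"
    using I(3) by (simp add: algebra_simps)
  then show ?thesis unfolding quad_covariation_def using I by blast
qed

lemma quad_covariation_cont_commute:
  "quad_covariation_cont P F T X Y C \<Longrightarrow> quad_covariation_cont P F T Y X C"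
  unfolding quad_covariation_cont_def using quad_covariation_commute
  by (simp only: mult.commute[of "jump (\<lambda>v. X v _) _"]) blast

lemma quad_covariation_cadlag:
  assumes "quad_covariation P F T X Y Q"
  shows "AE \<omega> in P. cadlag_path T (\<lambda>t. X t \<omega>)" "AE \<omega> in P. cadlag_path T (\<lambda>t. Y t \<omega>)"
  using assms by (auto simp: quad_covariation_def ito_integral_def cadlag_process_def)

lemma quad_covariation_unique:
  assumes "quad_covariation P F T X Y Q" "quad_covariation P F T X Y Q'" "0 < T"
  shows "indistinguishable P T Q Q'"
proof -
  obtain I I' where 1: "ito_integral P F T X Y I" "ito_integral P F T Y X I'"
    "indistinguishable P T Q (\<lambda>t \<omega>. X t \<omega> * Y t \<omega> - X 0 \<omega> * Y 0 \<omega> - I t \<omega> - I' t \<omega>)"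
    using assms by (auto simp: quad_covariation_def)
  obtain J J' where 2: "ito_integral P F T X Y J" "ito_integral P F T Y X J'"
    "indistinguishable P T Q' (\<lambda>t \<omega>. X t \<omega> * Y t \<omega> - X 0 \<omega> * Y 0 \<omega> - J t \<omega> - J' t \<omega>)"
    using assms by (auto simp: quad_covariation_def)
  have refl: "indistinguishable P T Z Z" for Z by (simp add: indistinguishable_def)
  show ?thesis
    using ito_integral_unique[OF 1(1) 2(1) assms(3) refl] 
      ito_integral_unique[OF 1(2) 2(2) assms(3) refl] 1(3) 2(3)
    unfolding indistinguishable_def by eventually_elim auto
qed

text \<open>
  The two integrals converge along a common subsequence, and summation by parts turns the
  Riemann sums into covariation sums.
\<close>

lemma quad_covariation_covsum:
  assumes "quad_covariation P F T X Y Q" "0 < T"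
  obtains r where "strict_mono r"
    "AE \<omega> in P. uniform_limit {0..T} 
       (\<lambda>n. covsum T (r n) (\<lambda>t. X t \<omega>) (\<lambda>t. Y t \<omega>)) (\<lambda>t. Q t \<omega>) sequentially"
proof -
  obtain I I' where 1: "ito_integral P F T X Y I" "ito_integral P F T Y X I'"
    "indistinguishable P T Q (\<lambda>t \<omega>. X t \<omega> * Y t \<omega> - X 0 \<omega> * Y 0 \<omega> - I t \<omega> - I' t \<omega>)"
    using assms by (auto simp: quad_covariation_def)
  obtain s where s: "strict_mono s"
    "AE \<omega> in P. uniform_limit {0..T} 
       (\<lambda>n. riemann T (s n) (\<lambda>t. X t \<omega>) (\<lambda>t. Y t \<omega>)) (\<lambda>t. I t \<omega>) sequentially"
    using ito_integral_riemann[OF 1(1) assms(2), of "\<lambda>n. n"] by (auto simp: strict_mono_def)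
  obtain s' where s': "strict_mono s'"
    "AE \<omega> in P. uniform_limit {0..T} 
       (\<lambda>n. riemann T (s (s' n)) (\<lambda>t. Y t \<omega>) (\<lambda>t. X t \<omega>)) (\<lambda>t. I' t \<omega>) sequentially"
    using ito_integral_riemann[OF 1(2) assms(2) s(1)] by blast
  have "AE \<omega> in P. uniform_limit {0..T} 
       (\<lambda>n. covsum T (s (s' n)) (\<lambda>t. X t \<omega>) (\<lambda>t. Y t \<omega>)) (\<lambda>t. Q t \<omega>) sequentially"
    using s(2) s'(2) indistinguishableD[OF 1(3)]
  proof eventually_elim
    case (elim \<omega>)
    have "uniform_limit {0..T} (\<lambda>n. riemann T (s (s' n)) (\<lambda>t. X t \<omega>) (\<lambda>t. Y t \<omega>)) (\<lambda>t. I t \<omega>) sequentially"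
      using filterlim_compose[OF elim(1) filterlim_subseq[OF s'(1)]] by simp
    then have "uniform_limit {0..T} (\<lambda>n t. X t \<omega> * Y t \<omega> - X 0 \<omega> * Y 0 \<omega>
        - riemann T (s (s' n)) (\<lambda>t. X t \<omega>) (\<lambda>t. Y t \<omega>) t - riemann T (s (s' n)) (\<lambda>t. Y t \<omega>) (\<lambda>t. X t \<omega>) t)
        (\<lambda>t. X t \<omega> * Y t \<omega> - X 0 \<omega> * Y 0 \<omega> - I t \<omega> - I' t \<omega>) sequentially"
      by (intro uniform_limit_minus uniform_limit_const elim)
    then show ?case
      by (rule uniform_limit_cong'[THEN iffD1, rotated 2])
         (use elim in \<open>auto simp: covsum_eq_riemann\<close>)
  qed
  then show ?thesis using that[of "\<lambda>n. s (s' n)"] s(1) s'(1) by (auto simp: strict_mono_def)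
qed

text \<open>
  The two kinds of finite-variation paths that occur here: time and \<open>[S]\<close> are continuous and
  nondecreasing, the counting processes and their power sums are step paths. Only \<open>S\<close> need be of neither kind.
\<close>

definition tame_path :: "real \<Rightarrow> (real \<Rightarrow> real) \<Rightarrow> bool" where
  "tame_path T y \<longleftrightarrow> (\<exists>D c. step_path T y D c) \<or> (continuous_on {0..T} y \<and> mono_on {0..T} y)"

lemma covsum_tame_tendsto:
  assumes y: "tame_path T y" and x: "cadlag_path T x" and t: "t \<in> {0..T}"
  shows "(\<lambda>n. covsum T n x y t) \<longlonglongrightarrow> (\<Sum>\<^sub>\<infinity>u\<in>{0<..t}. jump x u * jump y u)"
  using y unfolding tame_path_def
proof (elim disjE exE conjE)
  fix D c assume s: "step_path T y D c"
  have "(\<Sum>\<^sub>\<infinity>u\<in>{0<..t}. jump x u * jump y u) = (\<Sum>\<^sub>\<infinity>u\<in>D \<inter> {..t}. jump x u * jump y u)"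
    using step_path_jump[OF s] t step_pathD(2)[OF s] by (intro infsum_cong_neutral) auto
  also have "\<dots> = (\<Sum>u\<in>D \<inter> {..t}. jump x u * jump y u)"
    using step_pathD(1)[OF s] by simp
  finally show ?thesis using covsum_step_path_tendsto[OF s x t] by simp
next
  assume c: "continuous_on {0..T} y" "mono_on {0..T} y"
  have "(\<Sum>\<^sub>\<infinity>u\<in>{0<..t}. jump x u * jump y u) = 0"
    using continuous_path_jump[OF c(1)] t by (intro infsum_0) auto
  then show ?thesis using covsum_continuous_mono_tendsto[OF c x t] by simp
qed

text \<open>
  If one of the two processes has finite variation, the covariation is the sum of the products of
  the jumps, so its continuous part vanishes.
\<close>

lemma quad_covariation_cont_tame:
  assumes C: "quad_covariation_cont P F T X Y C" and T: "0 < T"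
    and Y: "AE \<omega> in P. tame_path T (\<lambda>t. Y t \<omega>)"
  shows "indistinguishable P T C (\<lambda>t \<omega>. 0)"
proof -
  obtain Q where Q: "quad_covariation P F T X Y Q" 
    and CQ: "indistinguishable P T C
          (\<lambda>t \<omega>. Q t \<omega> - (\<Sum>\<^sub>\<infinity>u\<in>{0<..t}. jump (\<lambda>v. X v \<omega>) u * jump (\<lambda>v. Y v \<omega>) u))"
    using C by (auto simp: quad_covariation_cont_def)
  obtain r where r: "strict_mono r"
    "AE \<omega> in P. uniform_limit {0..T} 
       (\<lambda>n. covsum T (r n) (\<lambda>t. X t \<omega>) (\<lambda>t. Y t \<omega>)) (\<lambda>t. Q t \<omega>) sequentially"
    using quad_covariation_covsum[OF Q T] by blast
  show ?thesis
    unfolding indistinguishable_def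
    using r(2) Y indistinguishableD[OF CQ] quad_covariation_cadlag(1)[OF Q]
  proof (eventually_elim, intro ballI)
    fix \<omega> t assume t: "t \<in> {0..T}" and 
      u: "uniform_limit {0..T} (\<lambda>n. covsum T (r n) (\<lambda>t. X t \<omega>) (\<lambda>t. Y t \<omega>)) (\<lambda>t. Q t \<omega>) sequentially" and
      *: "tame_path T (\<lambda>t. Y t \<omega>)" "cadlag_path T (\<lambda>t. X t \<omega>)" and
      eq: "\<forall>t\<in>{0..T}. C t \<omega> = Q t \<omega> - (\<Sum>\<^sub>\<infinity>u\<in>{0<..t}. jump (\<lambda>v. X v \<omega>) u * jump (\<lambda>v. Y v \<omega>) u)"
    have "(\<lambda>n. covsum T (r n) (\<lambda>t. X t \<omega>) (\<lambda>t. Y t \<omega>) t) 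
      \<longlonglongrightarrow> (\<Sum>\<^sub>\<infinity>u\<in>{0<..t}. jump (\<lambda>v. X v \<omega>) u * jump (\<lambda>v. Y v \<omega>) u)"
      using LIMSEQ_subseq_LIMSEQ[OF covsum_tame_tendsto[OF * t] r(1)] by (simp add: comp_def)
    then show "C t \<omega> = 0"
      using LIMSEQ_unique[OF tendsto_uniform_limitI[OF u t]] eq t by simp
  qed
qed

text \<open>
  Continuity and monotonicity are inherited from the covariation sums, the former because the
  convergence is uniform in time.
\<close>

lemma quad_variation_continuous_mono:
  assumes Q: "quad_covariation P F T S S Q" and T: "0 < T" 
    and S: "AE \<omega> in P. continuous_on {0..T} (\<lambda>t. S t \<omega>)"
  shows "AE \<omega> in P. continuous_on {0..T} (\<lambda>t. Q t \<omega>) \<and> mono_on {0..T} (\<lambda>t. Q t \<omega>)"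
proof -
  obtain r where r: "strict_mono r"
    "AE \<omega> in P. uniform_limit {0..T} 
       (\<lambda>n. covsum T (r n) (\<lambda>t. S t \<omega>) (\<lambda>t. S t \<omega>)) (\<lambda>t. Q t \<omega>) sequentially"
    using quad_covariation_covsum[OF Q T] by blast
  show ?thesis
    using r(2) S
  proof eventually_elim
    case (elim \<omega>)
    have "continuous_on {0..T} (\<lambda>t. Q t \<omega>)"
      by (rule uniform_limit_theorem[OF _ elim(1)])
         (auto intro!: always_eventually continuous_on_covsum elim(2))
    moreover have "mono_on {0..T} (\<lambda>t. Q t \<omega>)"
      by (rule covsum_self_limit_mono[OF elim(2) tendsto_uniform_limitI[OF elim(1)] r(1)])
    ultimately show ?case ..
  qed
qed

lemma quad_covariation_cont_continuous:
  assumes C: "quad_covariation_cont P F T S S C" and Q: "quad_covariation P F T S S Q" 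
    and T: "0 < T" and S: "AE \<omega> in P. continuous_on {0..T} (\<lambda>t. S t \<omega>)"
  shows "indistinguishable P T C Q"
proof -
  obtain Q' where Q': "quad_covariation P F T S S Q'" 
    and CQ: "indistinguishable P T C
          (\<lambda>t \<omega>. Q' t \<omega> - (\<Sum>\<^sub>\<infinity>u\<in>{0<..t}. jump (\<lambda>v. S v \<omega>) u * jump (\<lambda>v. S v \<omega>) u))"
    using C by (auto simp: quad_covariation_cont_def)
  show ?thesis
    unfolding indistinguishable_def
    using indistinguishableD[OF CQ] S indistinguishableD[OF quad_covariation_unique[OF Q' Q T]]
  proof (eventually_elim, intro ballI)
    fix \<omega> t assume t: "t \<in> {0..T}" and S: "continuous_on {0..T} (\<lambda>t. S t \<omega>)" and
      eq: "\<forall>t\<in>{0..T}. C t \<omega> = Q' t \<omega> - (\<Sum>\<^sub>\<infinity>u\<in>{0<..t}. jump (\<lambda>v. S v \<omega>) u * jump (\<lambda>v. S v \<omega>) u)"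
        "\<forall>t\<in>{0..T}. Q' t \<omega> = Q t \<omega>"
    have "(\<Sum>\<^sub>\<infinity>u\<in>{0<..t}. jump (\<lambda>v. S v \<omega>) u * jump (\<lambda>v. S v \<omega>) u) = 0"
      using continuous_path_jump[OF S] t by (intro infsum_0) auto
    then show "C t \<omega> = Q t \<omega>" using eq t by simp
  qed
qed

end

section \<open>The coefficients \<open>\<alpha>\<close>\<close>

lemma finite_compositions: "finite (compositions r k)"
proof (rule finite_subset)
  show "compositions r k \<subseteq> {is. set is \<subseteq> {..r} \<and> length is = k}"
    by (auto simp: compositions_def intro: member_le_sum_list)
qed (simp add: finite_lists_length_eq)

lemma alpha2_0: "alpha2 r 0 = of_bool (r = 0)"
proof -
  have "compositions r 0 = (if r = 0 then {[]} else {})" by (auto simp: compositions_def)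
  then show ?thesis by (simp add: alpha2_def)
qed

lemma alpha2_eq_0:
  assumes "r < k" shows "alpha2 r k = 0"
proof -
  have "length is \<le> sum_list is" if "\<forall>i\<in>set is. 1 \<le> i" for "is" :: "nat list"
    using that by (induction "is") auto
  then have "compositions r k = {}" using assms by (fastforce simp: compositions_def)
  then show ?thesis by (simp add: alpha2_def)
qed

lemma alpha2_Suc: "alpha2 r (Suc k) = (\<Sum>i=1..r. 1 / fact (i + 1) * alpha2 (r - i) k)"
proof -
  have "compositions r (Suc k) = (\<lambda>(i, is). i # is) ` (SIGMA i:{1..r}. compositions (r - i) k)"
  proof (intro equalityI subsetI)
    fix js assume "js \<in> compositions r (Suc k)"
    then show "js \<in> (\<lambda>(i, is). i # is) ` (SIGMA i:{1..r}. compositions (r - i) k)"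
      by (cases js) (auto simp: compositions_def image_iff)
  qed (auto simp: compositions_def)
  moreover have "inj_on (\<lambda>(i, is). i # is) X" for X :: "(nat \<times> nat list) set"
    by (auto simp: inj_on_def)
  ultimately have "alpha2 r (Suc k) 
    = (\<Sum>(i, is)\<in>(SIGMA i:{1..r}. compositions (r - i) k). 1 / fact (i + 1) * (\<Prod>i\<leftarrow>is. 1 / fact (i + 1)))"
    by (simp add: alpha2_def sum.reindex case_prod_unfold)
  also have "\<dots> = (\<Sum>i=1..r. \<Sum>is\<in>compositions (r - i) k. 1 / fact (i + 1) * (\<Prod>i\<leftarrow>is. 1 / fact (i + 1)))"
    by (subst sum.Sigma) (auto simp: finite_compositions)
  finally show ?thesis by (simp only: alpha2_def sum_distrib_left)
qed

text \<open>
  With \<open>\<alpha>(0) = 1\<close> the coefficients are those of the power series \<open>x / (exp x - 1)\<close>.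
\<close>

definition alpha_coeff :: "nat \<Rightarrow> real" where
  "alpha_coeff r = (if r = 0 then 1 else alpha r)"

lemma alpha_coeff_eq:
  assumes "r \<le> m" shows "alpha_coeff r = (\<Sum>k\<le>m. (-1) ^ k * alpha2 r k)"
proof -
  have "(\<Sum>k\<le>m. (-1) ^ k * alpha2 r k) = (\<Sum>k\<le>r. (-1) ^ k * alpha2 r k)"
    using assms by (intro sum.mono_neutral_right) (auto simp: alpha2_eq_0)
  also have "\<dots> = alpha2 r 0 + (\<Sum>k=1..r. (-1) ^ k * alpha2 r k)"
    by (simp add: atMost_atLeast0 sum.atLeast_Suc_atMost)
  finally show ?thesis by (auto simp: alpha_coeff_def alpha_def alpha2_0)
qed

text \<open>
  The coefficientwise form of \<open>x / (exp x - 1) * (exp x - 1) / x = 1\<close>. Splitting off the first part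
  \<open>i\<close> of a composition of \<open>q\<close> gives \<open>\<alpha>(q) = - \<Sum>\<^sub>i \<alpha>(q - i) / (i + 1)!\<close>.
\<close>

lemma alpha_coeff_convolution:
  "(\<Sum>r\<le>q. alpha_coeff r / fact (q - r + 1)) = of_bool (q = 0)"
proof (cases q)
  case 0
  then show ?thesis by (simp add: alpha_coeff_def)
next
  case (Suc m)
  have "alpha_coeff q = (\<Sum>k\<le>Suc m. (-1) ^ k * alpha2 q k)"
    using Suc by (intro alpha_coeff_eq) simp
  also have "\<dots> = (\<Sum>k\<le>m. (-1) ^ Suc k * alpha2 q (Suc k))"
    using Suc by (subst sum.atMost_Suc_shift) (simp add: alpha2_0)
  also have "\<dots> = - (\<Sum>k\<le>m. \<Sum>i=1..q. (-1) ^ k * (1 / fact (i + 1) * alpha2 (q - i) k))"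
    by (simp add: alpha2_Suc sum_distrib_left sum_negf)
  also have "\<dots> = - (\<Sum>i=1..q. \<Sum>k\<le>m. (-1) ^ k * (1 / fact (i + 1) * alpha2 (q - i) k))"
    by (subst sum.swap) simp
  also have "\<dots> = - (\<Sum>i=1..q. alpha_coeff (q - i) / fact (i + 1))"
  proof -
    have "(\<Sum>k\<le>m. (-1) ^ k * (1 / fact (i + 1) * alpha2 (q - i) k)) = alpha_coeff (q - i) / fact (i + 1)"
      if "i \<in> {1..q}" for i
      using that Suc by (subst alpha_coeff_eq[of _ m]) (auto simp: sum_divide_distrib)
    then show ?thesis by simp
  qed
  finally have "alpha_coeff q + (\<Sum>i=1..q. alpha_coeff (q - i) / fact (i + 1)) = 0" by simp
  also have "alpha_coeff q + (\<Sum>i=1..q. alpha_coeff (q - i) / fact (i + 1))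
    = (\<Sum>i\<le>q. alpha_coeff (q - i) / fact (i + 1))"
    by (simp add: atMost_atLeast0 sum.atLeast_Suc_atMost)
  also have "\<dots> = (\<Sum>r\<le>q. alpha_coeff r / fact (q - r + 1))"
    by (rule sum.reindex_bij_witness[of _ "\<lambda>r. q - r" "\<lambda>i. q - i"]) auto
  finally show ?thesis using Suc by simp
qed

text \<open>
  The coefficients \<open>\<alpha>\<close> invert the triangular system \<open>y r = \<Sum>\<^sub>p w (r + p) / (p + 1)!\<close>: after
  collecting the terms with \<open>r + p = q\<close>, only \<open>q = 0\<close> survives.
\<close>

lemma alpha_inversion:
  fixes w :: "nat \<Rightarrow> real"
  shows "(\<Sum>r\<le>R. alpha_coeff r * (\<Sum>p\<le>R - r. w (r + p) / fact (p + 1))) = w 0"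
proof -
  have "(\<Sum>r\<le>R. alpha_coeff r * (\<Sum>p\<le>R - r. w (r + p) / fact (p + 1)))
    = (\<Sum>(r, p)\<in>(SIGMA r:{..R}. {..R - r}). alpha_coeff r * (w (r + p) / fact (p + 1)))"
    by (subst sum.Sigma[symmetric]) (auto simp: sum_distrib_left)
  also have "\<dots> = (\<Sum>(q, r)\<in>(SIGMA q:{..R}. {..q}). w q * (alpha_coeff r / fact (q - r + 1)))"
    by (rule sum.reindex_bij_witness[of _ "\<lambda>(q, r). (r, q - r)" "\<lambda>(r, p). (r + p, r)"]) auto
  also have "\<dots> = (\<Sum>q\<le>R. w q * (\<Sum>r\<le>q. alpha_coeff r / fact (q - r + 1)))"
    by (subst sum.Sigma[symmetric]) (auto simp: sum_distrib_left)
  also have "\<dots> = (\<Sum>q\<le>R. w q * of_bool (q = 0))"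
    by (simp only: alpha_coeff_convolution)
  also have "\<dots> = (\<Sum>q\<in>{0}. w q * of_bool (q = 0))"
    by (intro sum.mono_neutral_right) auto
  finally show ?thesis by simp
qed

section \<open>Splittings of words\<close>

lemma finite_splits: "finite {(J1, J2). J1 @ J2 = J \<and> Q J1 J2}"
proof (rule finite_subset)
  show "{(J1, J2). J1 @ J2 = J \<and> Q J1 J2} \<subseteq> (\<lambda>k. (take k J, drop k J)) ` {..length J}"
  proof clarify
    fix J1 J2 show "(J1, J2) \<in> (\<lambda>k. (take k (J1 @ J2), drop k (J1 @ J2))) ` {..length (J1 @ J2)}"
      by (rule image_eqI[of _ _ "length J1"]) auto
  qed
qed simp

text \<open>
  Both the tilde transform and the jump term of a signature only see the constant suffixes of a
  word; these are the \<open>R\<close> nonempty suffixes of its maximal block of the letter \<open>a\<close> at the end.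
\<close>

lemma maximal_suffix:
  obtains J0 R where "J = J0 @ replicate R a" "J0 = [] \<or> last J0 \<noteq> a"
proof -
  have "\<exists>J0 R. J = J0 @ replicate R a \<and> (J0 = [] \<or> last J0 \<noteq> a)"
  proof (induction J rule: rev_induct)
    case (snoc x J)
    then obtain J0 R where J: "J = J0 @ replicate R a" "J0 = [] \<or> last J0 \<noteq> a" by blast
    show ?case
    proof (cases "x = a")
      case True
      then have "J @ [x] = J0 @ replicate (Suc R) a" using J by (simp add: replicate_append_same)
      then show ?thesis using J by blast
    next
      case False
      then show ?thesis by (intro exI[of _ "J @ [x]"] exI[of _ 0]) auto
    qed
  qed auto
  then show ?thesis using that by blast
qed

lemma sum_constant_suffixes:
  assumes J: "J = J0 @ replicate R a" and J0: "J0 = [] \<or> last J0 \<noteq> a"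
  shows "(\<Sum>(J1, J2) | J1 @ J2 = J \<and> J2 \<noteq> []. if set J2 \<subseteq> {a} then f J1 (length J2) else 0)
    = (\<Sum>r=1..R. f (J0 @ replicate (R - r) a) r)"
proof -
  have "(\<Sum>(J1, J2) | J1 @ J2 = J \<and> J2 \<noteq> []. if set J2 \<subseteq> {a} then f J1 (length J2) else 0)
    = (\<Sum>(J1, J2) | J1 @ J2 = J \<and> J2 \<noteq> [] \<and> set J2 \<subseteq> {a}. f J1 (length J2))"
    by (rule sum.mono_neutral_cong_right) (auto simp: finite_splits split: if_splits)
  also have "\<dots> = (\<Sum>r=1..R. f (J0 @ replicate (R - r) a) r)"
  proof (rule sum.reindex_bij_witness[of _ "\<lambda>r. (J0 @ replicate (R - r) a, replicate r a)" 
        "\<lambda>(J1, J2). length J2"])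
    fix x assume "x \<in> {(J1, J2). J1 @ J2 = J \<and> J2 \<noteq> [] \<and> set J2 \<subseteq> {a}}"
    then obtain J1 J2 where x: "x = (J1, J2)" "J1 @ J2 = J" "J2 \<noteq> []" "set J2 \<subseteq> {a}" by auto
    define r where "r = length J2"
    have J2: "J2 = replicate r a"
      using x unfolding r_def by (intro replicate_eqI) auto
    \<comment> \<open>Otherwise \<open>J0\<close> would end in \<open>a\<close>, against the maximality of the block.\<close>
    have "r \<le> R"
    proof (rule ccontr)
      assume "\<not> r \<le> R"
      then have "replicate r a = replicate (r - R) a @ replicate R a"
        by (simp add: replicate_add[symmetric])
      then have "J1 @ replicate (r - R) a = J0" using x(2) J J2 by simp
      moreover have "last (J1 @ replicate (r - R) a) = a" "J1 @ replicate (r - R) a \<noteq> []" 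
        using \<open>\<not> r \<le> R\<close> by auto
      ultimately show False using J0 by metis
    qed
    then have "replicate R a = replicate (R - r) a @ replicate r a"
      by (simp add: replicate_add[symmetric])
    then have J1: "J1 = J0 @ replicate (R - r) a" using x(2) J J2 by simp
    have "r \<ge> 1" using x r_def by (cases J2) auto
    then show "(case x of (J1, J2) \<Rightarrow> length J2) \<in> {1..R}"
      "(J0 @ replicate (R - (case x of (J1, J2) \<Rightarrow> length J2)) a,
        replicate (case x of (J1, J2) \<Rightarrow> length J2) a) = x"
      "f (J0 @ replicate (R - (case x of (J1, J2) \<Rightarrow> length J2)) a) (case x of (J1, J2) \<Rightarrow> length J2)
        = (case x of (J1, J2) \<Rightarrow> f J1 (length J2))"
      using x(1) J1 J2 \<open>r \<le> R\<close> by (auto simp: r_def[symmetric])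
  next
    fix r assume "r \<in> {1..R}"
    then show "(J0 @ replicate (R - r) a, replicate r a) 
      \<in> {(J1, J2). J1 @ J2 = J \<and> J2 \<noteq> [] \<and> set J2 \<subseteq> {a}}"
      using J by (auto simp: replicate_add[symmetric])
  qed auto
  finally show ?thesis .
qed

text \<open>
  A suffix of length at least two of \<open>J @ [i]\<close> is a nonempty suffix of \<open>J\<close> followed by \<open>i\<close>.
\<close>

lemma jump_term_snoc:
  "jump_term X XX (J @ [i]) u \<omega> = (\<Sum>(J1, J2) | J1 @ J2 = J \<and> J2 \<noteq> [].
     1 / fact (length J2 + 1) * left_lim (\<lambda>v. XX J1 v \<omega>) u *
     ((\<Prod>i\<leftarrow>J2. jump (\<lambda>v. X i v \<omega>) u) * jump (\<lambda>v. X i v \<omega>) u))"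
proof -
  have "jump_term X XX (J @ [i]) u \<omega> = (\<Sum>(J1, J2) | J1 @ J2 = J @ [i] \<and> 1 < length J2.
     1 / fact (length J2) * of_bool (1 < length J2) * left_lim (\<lambda>v. XX J1 v \<omega>) u *
     (\<Prod>i\<leftarrow>J2. jump (\<lambda>v. X i v \<omega>) u))"
    unfolding jump_term_def
    using finite_splits[of "J @ [i]" "\<lambda>_ _. True"]
    by (intro sum.mono_neutral_right) auto
  also have "\<dots> = (\<Sum>(J1, J2) | J1 @ J2 = J \<and> J2 \<noteq> [].
     1 / fact (length J2 + 1) * left_lim (\<lambda>v. XX J1 v \<omega>) u *
     ((\<Prod>i\<leftarrow>J2. jump (\<lambda>v. X i v \<omega>) u) * jump (\<lambda>v. X i v \<omega>) u))"
  proof (rule sum.reindex_bij_witness[of _ "\<lambda>(J1, J2). (J1, J2 @ [i])" "\<lambda>(J1, J2). (J1, butlast J2)"])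
    fix x assume "x \<in> {(J1, J2). J1 @ J2 = J @ [i] \<and> 1 < length J2}"
    then obtain J1 J2 where x: "x = (J1, J2)" "J1 @ J2 = J @ [i]" "1 < length J2" by auto
    obtain J3 y where J3: "J2 = J3 @ [y]" using x(3) by (cases J2 rule: rev_cases) auto
    have "y = i" "J1 @ J3 = J" using x(2) unfolding J3 by simp_all
    then show "(case case x of (J1, J2) \<Rightarrow> (J1, butlast J2) of (J1, J2) \<Rightarrow> (J1, J2 @ [i])) = x"
      "(case x of (J1, J2) \<Rightarrow> (J1, butlast J2)) \<in> {(J1, J2). J1 @ J2 = J \<and> J2 \<noteq> []}"
      "(case case x of (J1, J2) \<Rightarrow> (J1, butlast J2) of
        (J1, J2) \<Rightarrow> 1 / fact (length J2 + 1) * left_lim (\<lambda>v. XX J1 v \<omega>) u *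
          ((\<Prod>i\<leftarrow>J2. jump (\<lambda>v. X i v \<omega>) u) * jump (\<lambda>v. X i v \<omega>) u)) =
       (case x of (J1, J2) \<Rightarrow> 1 / fact (length J2) * of_bool (1 < length J2) * left_lim (\<lambda>v. XX J1 v \<omega>) u *
          (\<Prod>i\<leftarrow>J2. jump (\<lambda>v. X i v \<omega>) u))"
      using x(1,3) J3 by auto
  qed auto
  finally show ?thesis .
qed

section \<open>Linearity of the pairing\<close>

lemma pairing_superset:
  assumes "finite A" "Poly_Mapping.keys u \<subseteq> A"
  shows "pairing u x = (\<Sum>J\<in>A. Poly_Mapping.lookup u J * x J)"
  unfolding pairing_def using assms
  by (intro sum.mono_neutral_left) (auto simp: in_keys_iff)

lemma pairing_add: "pairing (u + v) x = pairing u x + pairing v x"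
proof -
  let ?A = "Poly_Mapping.keys u \<union> Poly_Mapping.keys v"
  show ?thesis
    using keys_add[of u v]
    by (simp add: pairing_superset[of ?A] lookup_add distrib_right sum.distrib)
qed

lemma pairing_diff: "pairing (u - v) x = pairing u x - pairing v x"
  using pairing_add[of "u - v" v x] by simp

lemma pairing_0: "pairing 0 x = 0"
  by (simp add: pairing_def)

lemma pairing_sum: "pairing (\<Sum>i\<in>A. f i) x = (\<Sum>i\<in>A. pairing (f i) x)"
  by (induction A rule: infinite_finite_induct) (auto simp: pairing_add pairing_0)

lemma pairing_basis: "pairing (basis J) x = x J"
  by (simp add: pairing_def)

lemma pairing_scale_basis: "pairing (scale c (basis J)) x = c * x J"
  by (cases "c = 0") (simp_all add: pairing_def scale_def)

section \<open>The state process\<close>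

lemma step_path_power_jumps:
  assumes N: "step_path T (\<lambda>t. N t \<omega>) D c" and m: "1 \<le> m"
  obtains c' where "step_path T (\<lambda>t. power_jumps m N t \<omega>) D c'"
    "\<And>u. u \<in> {0<..T} \<Longrightarrow> jump (\<lambda>t. power_jumps m N t \<omega>) u = jump (\<lambda>t. N t \<omega>) u ^ m"
proof -
  define c' where "c' u = c u ^ m" for u
  have D: "finite D" "D \<subseteq> {0<..T}" using step_pathD[OF N] by auto
  have jump: "jump (\<lambda>t. N t \<omega>) u = (if u \<in> D then c u else 0)" if "u \<in> {0<..T}" for u
    using step_path_jump[OF N] that by auto
  have step: "step_path T (\<lambda>t. power_jumps m N t \<omega>) D c'"
  proof (cases "m = 1")
    case True
    then show ?thesis using N by (simp add: power_jumps_def c'_def[abs_def])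
  next
    case False
    have "power_jumps m N t \<omega> = (\<Sum>u\<in>D \<inter> {..t}. c' u)" if t: "t \<in> {0..T}" for t
    proof -
      have "(\<Sum>\<^sub>\<infinity>u\<in>{0<..t}. jump (\<lambda>v. N v \<omega>) u ^ m) = (\<Sum>\<^sub>\<infinity>u\<in>D \<inter> {..t}. c' u)"
        using jump D t m by (intro infsum_cong_neutral) (auto simp: c'_def zero_power)
      then show ?thesis using False D by (simp add: power_jumps_def)
    qed
    moreover have "power_jumps m N 0 \<omega> = 0" using False by (simp add: power_jumps_def)
    ultimately show ?thesis unfolding step_path_def using D by simp
  qed
  moreover have "jump (\<lambda>t. power_jumps m N t \<omega>) u = jump (\<lambda>t. N t \<omega>) u ^ m" if "u \<in> {0<..T}" for u
    using step_path_jump[OF step, of u] jump[of u] that m by (auto simp: c'_def zero_power)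
  ultimately show ?thesis using that by blast
qed

text \<open>
  The properties of the paths of the state process that hold almost surely and to which
  all pathwise computations refer.
\<close>

definition regular_state :: "real \<Rightarrow> (real \<Rightarrow> real) \<Rightarrow> (real \<Rightarrow> real) \<Rightarrow> (real \<Rightarrow> real) \<Rightarrow> (real \<Rightarrow> real) \<Rightarrow> bool" where
  "regular_state T s qs na nb \<longleftrightarrow> continuous_on {0..T} s \<and> 
     continuous_on {0..T} qs \<and> mono_on {0..T} qs \<and>
     (\<exists>D c. step_path T na D c) \<and> (\<exists>D c. step_path T nb D c) \<and>
     (\<forall>u\<in>{0<..T}. jump na u * jump nb u = 0)"

locale state_signature = filtered_prob_space P F for P :: "'a measure" and F +
  fixes T :: real and S QS Na Nb :: "'a process" and YY :: "letter list \<Rightarrow> 'a process" and M :: nat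
  assumes T: "0 < T" and M: "1 \<le> M"
    and S_cont: "AE \<omega> in P. continuous_on {0..T} (\<lambda>t. S t \<omega>)"
    and QS: "quad_covariation P F T S S QS"
    and Na: "counting_process P F T Na" and Nb: "counting_process P F T Nb"
    and no_common_jumps: "AE \<omega> in P. \<forall>t\<in>{0<..T}. jump (\<lambda>u. Na u \<omega>) t * jump (\<lambda>u. Nb u \<omega>) t = 0"
    and sig: "signature P F T (alphabet M) (state_process S QS Na Nb) YY"
begin

abbreviation Y :: "letter \<Rightarrow> 'a process" where
  "Y \<equiv> state_process S QS Na Nb"

abbreviation regular :: "'a \<Rightarrow> bool" where
  "regular \<omega> \<equiv> regular_state T (\<lambda>t. S t \<omega>) (\<lambda>t. QS t \<omega>) (\<lambda>t. Na t \<omega>) (\<lambda>t. Nb t \<omega>)"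

lemma counting_process_step:
  assumes "counting_process P F T N"
  shows "AE \<omega> in P. \<exists>D c. step_path T (\<lambda>t. N t \<omega>) D c"
proof -
  have "AE \<omega> in P. cadlag_path T (\<lambda>t. N t \<omega>)" "AE \<omega> in P. \<forall>t\<in>{0..T}. N t \<omega> \<in> \<nat>"
    using assms by (auto simp: counting_process_def cadlag_process_def)
  then show ?thesis
  proof eventually_elim
    case (elim \<omega>)
    then show ?case using nat_valued_cadlag_step[OF elim(1)] T by (metis less_imp_le)
  qed
qed

lemma AE_regular: "AE \<omega> in P. regular \<omega>"
  using S_cont quad_variation_continuous_mono[OF QS T S_cont] no_common_jumps
    counting_process_step[OF Na] counting_process_step[OF Nb]
  by eventually_elim (auto simp: regular_state_def)

lemma jump_continuous_letter:
  assumes "regular \<omega>" "i \<in> {L0, Ls, Lqs}" "u \<in> {0<..T}"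
  shows "jump (\<lambda>t. Y i t \<omega>) u = 0"
proof -
  have "continuous_on {0..T} (\<lambda>t. Y i t \<omega>)"
    using assms by (auto simp: regular_state_def)
  then show ?thesis using assms continuous_path_jump by auto
qed

lemma tame_letter:
  assumes "regular \<omega>" "i \<in> alphabet M" "i \<noteq> Ls"
  shows "tame_path T (\<lambda>t. Y i t \<omega>)"
proof (cases i)
  case L0
  then show ?thesis by (auto simp: tame_path_def intro!: mono_onI)
next
  case Lqs
  then show ?thesis using assms by (auto simp: tame_path_def regular_state_def)
next
  case (La m)
  then have m: "1 \<le> m" using assms by (auto simp: alphabet_def)
  obtain D c where D: "step_path T (\<lambda>t. Na t \<omega>) D c"
    using assms by (auto simp: regular_state_def)
  obtain c' where "step_path T (\<lambda>t. power_jumps m Na t \<omega>) D c'"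
    using step_path_power_jumps[of T Na \<omega> D c m, OF D m] by metis
  then show ?thesis using La by (auto simp: tame_path_def)
next
  case (Lb m)
  then have m: "1 \<le> m" using assms by (auto simp: alphabet_def)
  obtain D c where D: "step_path T (\<lambda>t. Nb t \<omega>) D c"
    using assms by (auto simp: regular_state_def)
  obtain c' where "step_path T (\<lambda>t. power_jumps m Nb t \<omega>) D c'"
    using step_path_power_jumps[of T Nb \<omega> D c m, OF D m] by metis
  then show ?thesis using Lb by (auto simp: tame_path_def)
qed (use assms in auto)

lemma signature_snoc:
  assumes J: "J \<in> lists (alphabet M)" and i: "i \<in> alphabet M"
  obtains I K where "ito_integral P F T (YY J) (Y i) I"
    "J \<noteq> [] \<longrightarrow> (\<exists>C. quad_covariation_cont P F T (Y (last J)) (Y i) C \<and>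
        ito_integral P F T (YY (butlast J)) C K)"
    "indistinguishable P T (YY (J @ [i])) (\<lambda>t \<omega>. I t \<omega> + 1 / 2 * of_bool (J \<noteq> []) * K t \<omega> +
             (\<Sum>\<^sub>\<infinity>u\<in>{0<..t}. jump_term Y YY (J @ [i]) u \<omega>))"
proof -
  have "J @ [i] \<in> lists (alphabet M)" "J @ [i] \<noteq> []" using assms by auto
  then obtain I K where "ito_integral P F T (YY (butlast (J @ [i]))) (Y (last (J @ [i]))) I"
    "1 < length (J @ [i]) \<longrightarrow> (\<exists>C.
           quad_covariation_cont P F T (Y (last (butlast (J @ [i])))) (Y (last (J @ [i]))) C \<and>
           ito_integral P F T (YY (butlast (butlast (J @ [i])))) C K)"
    "indistinguishable P T (YY (J @ [i]))
          (\<lambda>t \<omega>. I t \<omega> + 1 / 2 * of_bool (1 < length (J @ [i])) * K t \<omega> +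
             (\<Sum>\<^sub>\<infinity>u\<in>{0<..t}. jump_term Y YY (J @ [i]) u \<omega>))"
    using sig unfolding signature_def by blast
  then show ?thesis using that[of I K] by simp
qed

text \<open>
  Unless the last two letters are both the price, one of the last two components has finite
  variation. Their continuous covariation then vanishes, and with it the correction term.
\<close>

lemma signature_snoc_tame:
  assumes J: "J \<in> lists (alphabet M)" and i: "i \<in> alphabet M"
    and tame: "J = [] \<or> last J \<noteq> Ls \<or> i \<noteq> Ls"
    and I: "ito_integral P F T (YY J) (Y i) I"
  shows "indistinguishable P T (YY (J @ [i]))
    (\<lambda>t \<omega>. I t \<omega> + (\<Sum>\<^sub>\<infinity>u\<in>{0<..t}. jump_term Y YY (J @ [i]) u \<omega>))"
proof -
  obtain I' K where I': "ito_integral P F T (YY J) (Y i) I'"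
    and K: "J \<noteq> [] \<longrightarrow> (\<exists>C. quad_covariation_cont P F T (Y (last J)) (Y i) C \<and>
        ito_integral P F T (YY (butlast J)) C K)"
    and eq: "indistinguishable P T (YY (J @ [i])) (\<lambda>t \<omega>. I' t \<omega> + 1 / 2 * of_bool (J \<noteq> []) * K t \<omega> +
             (\<Sum>\<^sub>\<infinity>u\<in>{0<..t}. jump_term Y YY (J @ [i]) u \<omega>))"
    using signature_snoc[OF J i] by blast
  have "AE \<omega> in P. \<forall>t\<in>{0..T}. of_bool (J \<noteq> []) * K t \<omega> = 0"
  proof (cases "J = []")
    case False
    then obtain C where C: "quad_covariation_cont P F T (Y (last J)) (Y i) C" 
      "ito_integral P F T (YY (butlast J)) C K" using K by blast
    have letters: "last J \<in> alphabet M" "i \<in> alphabet M" using J i False by auto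
    have tame_AE: "AE \<omega> in P. tame_path T (\<lambda>t. Y k t \<omega>)" if "k \<in> alphabet M" "k \<noteq> Ls" for k
      using AE_regular by eventually_elim (rule tame_letter[OF _ that])
    have "indistinguishable P T C (\<lambda>t \<omega>. 0)"
    proof (cases "i = Ls")
      case True
      then have "last J \<noteq> Ls" using tame False by simp
      then show ?thesis
        using quad_covariation_cont_tame[OF quad_covariation_cont_commute[OF C(1)] T tame_AE] letters by simp
    next
      case False
      then show ?thesis
        using quad_covariation_cont_tame[OF C(1) T tame_AE] letters by simp
    qed
    then have "indistinguishable P T K (\<lambda>t \<omega>. 0)" by (rule ito_integral_null[OF C(2) T])
    then show ?thesis unfolding indistinguishable_def by eventually_elim simp
  qed simp
  moreover have "indistinguishable P T I I'"
    by (rule ito_integral_unique[OF I I' T]) (simp add: indistinguishable_def)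
  ultimately show ?thesis using eq unfolding indistinguishable_def by eventually_elim auto
qed

lemma jump_term_continuous_letter:
  assumes "regular \<omega>" "i \<in> {L0, Ls, Lqs}" "t \<in> {0..T}"
  shows "(\<Sum>\<^sub>\<infinity>u\<in>{0<..t}. jump_term Y YY (J @ [i]) u \<omega>) = 0"
proof (rule infsum_0)
  fix u assume "u \<in> {0<..t}"
  then have "jump (\<lambda>t. Y i t \<omega>) u = 0" using jump_continuous_letter assms by auto
  then show "jump_term Y YY (J @ [i]) u \<omega> = 0" unfolding jump_term_snoc by simp
qed

lemma signature_snoc_continuous_letter:
  assumes J: "J \<in> lists (alphabet M)" and i: "i \<in> {L0, Ls, Lqs}"
    and tame: "J = [] \<or> last J \<noteq> Ls \<or> i \<noteq> Ls"
    and I: "ito_integral P F T (YY J) (Y i) I"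
  shows "indistinguishable P T (YY (J @ [i])) I"
proof -
  have "i \<in> alphabet M" using i by (auto simp: alphabet_def)
  from signature_snoc_tame[OF J this tame I] show ?thesis
    unfolding indistinguishable_def using AE_regular
    by eventually_elim (simp add: jump_term_continuous_letter[OF _ i])
qed

text \<open>
  Here the correction term is \<open>\<integral> YY (butlast J) d[S]\<close>, since \<open>S\<close> is continuous. As \<open>[S]\<close> is again
  continuous and of finite variation, that integral is a signature coordinate without any
  correction of its own.
\<close>

lemma signature_snoc_price_price:
  assumes J: "J \<in> lists (alphabet M)" "J \<noteq> []" "last J = Ls"
    and I: "ito_integral P F T (YY J) (Y Ls) I"
  shows "indistinguishable P T (YY (J @ [Ls])) (\<lambda>t \<omega>. I t \<omega> + 1 / 2 * YY (butlast J @ [Lqs]) t \<omega>)"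
proof -
  have letters: "Ls \<in> alphabet M" "Lqs \<in> alphabet M" by (auto simp: alphabet_def)
  obtain I' K where I': "ito_integral P F T (YY J) (Y Ls) I'"
    and K: "J \<noteq> [] \<longrightarrow> (\<exists>C. quad_covariation_cont P F T (Y (last J)) (Y Ls) C \<and>
        ito_integral P F T (YY (butlast J)) C K)"
    and eq: "indistinguishable P T (YY (J @ [Ls])) (\<lambda>t \<omega>. I' t \<omega> + 1 / 2 * of_bool (J \<noteq> []) * K t \<omega> +
             (\<Sum>\<^sub>\<infinity>u\<in>{0<..t}. jump_term Y YY (J @ [Ls]) u \<omega>))"
    using signature_snoc[OF J(1) letters(1)] by blast
  obtain C where C: "quad_covariation_cont P F T S S C" "ito_integral P F T (YY (butlast J)) C K" 
    using K J by auto
  have J': "butlast J \<in> lists (alphabet M)" using J(1) by (auto dest: in_set_butlastD)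
  obtain K' where K': "ito_integral P F T (YY (butlast J)) (Y Lqs) K'"
    using signature_snoc[OF J' letters(2)] by blast
  have "indistinguishable P T (YY (butlast J @ [Lqs])) K'"
    by (rule signature_snoc_continuous_letter[OF J' _ _ K']) auto
  moreover have "indistinguishable P T K K'"
    by (rule ito_integral_unique[OF C(2) K' T])
       (use quad_covariation_cont_continuous[OF C(1) QS T S_cont] in simp)
  moreover have "indistinguishable P T I I'"
    by (rule ito_integral_unique[OF I I' T]) (simp add: indistinguishable_def)
  ultimately show ?thesis using eq AE_regular unfolding indistinguishable_def
    by eventually_elim (auto simp: jump_term_continuous_letter J(2))
qed

end

section \<open>Integrals against the counting processes\<close>

text \<open>
  The two counting processes play symmetric roles; \<open>L m\<close> is the letter of the \<open>m\<close>-th power sum of the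
  jumps of \<open>N\<close>.
\<close>

locale state_signature_counting = state_signature +
  fixes L :: "nat \<Rightarrow> letter" and N :: "'a process"
  assumes L: "L = La \<and> N = Na \<or> L = Lb \<and> N = Nb"
begin

lemma Y_L: "Y (L m) = power_jumps m N"
  using L by auto

lemma regular_step:
  assumes "regular \<omega>"
  obtains D c where "step_path T (\<lambda>t. N t \<omega>) D c"
  using assms L unfolding regular_state_def by blast

lemma jump_L:
  assumes "regular \<omega>" "u \<in> {0<..T}" "1 \<le> m"
  shows "jump (\<lambda>t. Y (L m) t \<omega>) u = jump (\<lambda>t. N t \<omega>) u ^ m"
proof -
  obtain D c where D: "step_path T (\<lambda>t. N t \<omega>) D c" using regular_step[OF assms(1)] .
  show ?thesis
    unfolding Y_L using step_path_power_jumps[of T N \<omega> D c m, OF D assms(3)] assms(2) by metis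
qed

lemma infsum_jump_eq_sum:
  assumes N: "step_path T (\<lambda>t. N t \<omega>) D c" and t: "t \<in> {0..T}"
    and f: "\<And>u. u \<in> {0<..t} \<Longrightarrow> jump (\<lambda>t. N t \<omega>) u = 0 \<Longrightarrow> f u = 0"
  shows "(\<Sum>\<^sub>\<infinity>u\<in>{0<..t}. f u) = (\<Sum>u\<in>D \<inter> {..t}. f u)"
proof -
  have "(\<Sum>\<^sub>\<infinity>u\<in>{0<..t}. f u) = (\<Sum>\<^sub>\<infinity>u\<in>D \<inter> {..t}. f u)"
    using step_path_jump[OF N] f t step_pathD(2)[OF N] by (intro infsum_cong_neutral) auto
  then show ?thesis using step_pathD(1)[OF N] by simp
qed

text \<open>
  The sums \<open>\<Sum> YY J (u-) (\<Delta>N u)\<^sup>m\<close> in which both the integrals and the signature coordinates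
  are expanded.
\<close>

definition jump_moment :: "letter list \<Rightarrow> nat \<Rightarrow> 'a process" where
  "jump_moment J m t \<omega> = 
     (\<Sum>\<^sub>\<infinity>u\<in>{0<..t}. left_lim (\<lambda>v. YY J v \<omega>) u * jump (\<lambda>v. N v \<omega>) u ^ m)"

lemma ito_integral_jump_moment:
  assumes I: "ito_integral P F T (YY J) (Y (L m)) I" and m: "1 \<le> m"
  shows "indistinguishable P T I (jump_moment J m)"
proof (rule ito_integral_pathwise[OF I T])
  have cadlag: "AE \<omega> in P. cadlag_path T (\<lambda>t. YY J t \<omega>)"
    using I by (auto simp: ito_integral_def cadlag_process_def)
  show "AE \<omega> in P. \<forall>t\<in>{0..T}. (\<lambda>n. riemann T n (\<lambda>t. YY J t \<omega>) (\<lambda>t. Y (L m) t \<omega>) t)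
    \<longlonglongrightarrow> jump_moment J m t \<omega>"
    using cadlag AE_regular
  proof (eventually_elim, intro ballI)
    fix \<omega> t assume z: "cadlag_path T (\<lambda>t. YY J t \<omega>)" and reg: "regular \<omega>" and t: "t \<in> {0..T}"
    obtain D c where D: "step_path T (\<lambda>t. N t \<omega>) D c" using regular_step[OF reg] .
    obtain c' where c': "step_path T (\<lambda>t. Y (L m) t \<omega>) D c'"
      using step_path_power_jumps[of T N \<omega> D c m, OF D m] unfolding Y_L by metis
    have "jump_moment J m t \<omega> = (\<Sum>u\<in>D \<inter> {..t}. left_lim (\<lambda>v. YY J v \<omega>) u * jump (\<lambda>v. N v \<omega>) u ^ m)"
      unfolding jump_moment_def using m by (intro infsum_jump_eq_sum[OF D t]) (simp add: zero_power)
    also have "\<dots> = (\<Sum>u\<in>D \<inter> {..t}. left_lim (\<lambda>v. YY J v \<omega>) u * jump (\<lambda>v. Y (L m) v \<omega>) u)"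
      using step_pathD(2)[OF D] jump_L[OF reg _ m] by (intro sum.cong) auto
    finally show "(\<lambda>n. riemann T n (\<lambda>t. YY J t \<omega>) (\<lambda>t. Y (L m) t \<omega>) t) \<longlonglongrightarrow> jump_moment J m t \<omega>"
      using riemann_step_path_tendsto[OF c' z t] by simp
  qed
qed

text \<open>
  At a jump of \<open>N\<close> every other component with a letter in \<open>{0, s, a, b}\<close> is continuous.
\<close>

lemma prod_jumps:
  assumes reg: "regular \<omega>" and u: "u \<in> {0<..T}" and m: "1 \<le> m"
    and J: "set J \<subseteq> {L0, Ls, La 1, Lb 1}"
  shows "(\<Prod>i\<leftarrow>J. jump (\<lambda>v. Y i v \<omega>) u) * jump (\<lambda>v. Y (L m) v \<omega>) u
    = (if set J \<subseteq> {L 1} then jump (\<lambda>v. N v \<omega>) u ^ (length J + m) else 0)"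
proof (cases "set J \<subseteq> {L 1}")
  case True
  then have "J = replicate (length J) (L 1)" by (intro replicate_eqI) auto
  then have "(\<Prod>i\<leftarrow>J. jump (\<lambda>v. Y i v \<omega>) u) = jump (\<lambda>v. Y (L 1) v \<omega>) u ^ length J"
    by (metis map_replicate prod_list_replicate)
  then show ?thesis using True by (simp add: jump_L[OF reg u m] jump_L[OF reg u order_refl, simplified] power_add)
next
  case False
  then obtain x where x: "x \<in> set J" "x \<noteq> L 1" by auto
  have "jump (\<lambda>v. Y x v \<omega>) u * jump (\<lambda>v. N v \<omega>) u = 0"
  proof (cases "x \<in> {L0, Ls}")
    case True
    then show ?thesis using jump_continuous_letter[OF reg _ u, of x] by auto
  next
    case False
    then have "(x = La 1 \<and> N = Nb) \<or> (x = Lb 1 \<and> N = Na)" using x J L by auto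
    moreover have "jump (\<lambda>v. Na v \<omega>) u * jump (\<lambda>v. Nb v \<omega>) u = 0"
      using reg u by (auto simp: regular_state_def)
    moreover have "power_jumps 1 Z = Z" for Z :: "'a process" 
      by (simp add: power_jumps_def fun_eq_iff)
    ultimately show ?thesis by auto
  qed
  moreover have "(\<Prod>i\<leftarrow>J. jump (\<lambda>v. Y i v \<omega>) u) = 0" if "jump (\<lambda>v. Y x v \<omega>) u = 0"
    using x(1) that by (auto simp: prod_list_zero_iff image_iff)
  moreover have "jump (\<lambda>v. Y (L m) v \<omega>) u = 0" if "jump (\<lambda>v. N v \<omega>) u = 0"
    using that m by (simp add: jump_L[OF reg u] zero_power)
  ultimately show ?thesis using False by auto
qed

lemma jump_term_counting:
  assumes reg: "regular \<omega>" and u: "u \<in> {0<..T}" and m: "1 \<le> m"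
    and J: "J \<in> lists {L0, Ls, La 1, Lb 1}" "J = J0 @ replicate R (L 1)" "J0 = [] \<or> last J0 \<noteq> L 1"
  shows "jump_term Y YY (J @ [L m]) u \<omega> = (\<Sum>p=1..R. 1 / fact (p + 1) *
    (left_lim (\<lambda>v. YY (J0 @ replicate (R - p) (L 1)) v \<omega>) u * jump (\<lambda>v. N v \<omega>) u ^ (p + m)))"
proof -
  define f where "f K p = 1 / fact (p + 1) * 
    (left_lim (\<lambda>v. YY K v \<omega>) u * jump (\<lambda>v. N v \<omega>) u ^ (p + m))" for K p
  have "jump_term Y YY (J @ [L m]) u \<omega> = (\<Sum>(J1, J2) | J1 @ J2 = J \<and> J2 \<noteq> [].
     if set J2 \<subseteq> {L 1} then f J1 (length J2) else 0)"
    unfolding jump_term_snoc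
  proof (intro sum.cong refl, clarify)
    fix J1 J2 assume "J = J1 @ J2"
    then have "set J2 \<subseteq> {L0, Ls, La 1, Lb 1}" using J(1) by auto
    then show "1 / fact (length J2 + 1) * left_lim (\<lambda>v. YY J1 v \<omega>) u *
       ((\<Prod>i\<leftarrow>J2. jump (\<lambda>v. Y i v \<omega>) u) * jump (\<lambda>v. Y (L m) v \<omega>) u) 
       = (if set J2 \<subseteq> {L 1} then f J1 (length J2) else 0)"
      unfolding prod_jumps[OF reg u m \<open>set J2 \<subseteq> _\<close>] by (simp add: f_def)
  qed
  also have "\<dots> = (\<Sum>p=1..R. f (J0 @ replicate (R - p) (L 1)) p)"
    by (rule sum_constant_suffixes[OF J(2,3)])
  finally show ?thesis by (simp add: f_def)
qed

text \<open>
  The term \<open>p = 0\<close> is the integral against the power sum; the other ones come from the suffixes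
  of \<open>p\<close> letters \<open>L 1\<close> in the jump term.
\<close>

lemma signature_snoc_counting:
  assumes J: "J \<in> lists {L0, Ls, La 1, Lb 1}" "J = J0 @ replicate R (L 1)" "J0 = [] \<or> last J0 \<noteq> L 1"
    and m: "1 \<le> m" "m \<le> M"
  shows "indistinguishable P T (YY (J @ [L m]))
    (\<lambda>t \<omega>. \<Sum>p\<le>R. 1 / fact (p + 1) * jump_moment (J0 @ replicate (R - p) (L 1)) (p + m) t \<omega>)"
proof -
  have lists: "J \<in> lists (alphabet M)" using J(1) M by (auto simp: alphabet_def)
  have letter: "L m \<in> alphabet M" "L m \<noteq> Ls" using L m by (auto simp: alphabet_def)
  obtain I where I: "ito_integral P F T (YY J) (Y (L m)) I"
    using signature_snoc[OF lists letter(1)] by blast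
  have sig_I: "indistinguishable P T (YY (J @ [L m]))
    (\<lambda>t \<omega>. I t \<omega> + (\<Sum>\<^sub>\<infinity>u\<in>{0<..t}. jump_term Y YY (J @ [L m]) u \<omega>))"
    by (rule signature_snoc_tame[OF lists letter(1) _ I]) (use letter in auto)
  show ?thesis
    unfolding indistinguishable_def
    using AE_regular indistinguishableD[OF sig_I] 
      indistinguishableD[OF ito_integral_jump_moment[OF I m(1)]]
  proof (eventually_elim, intro ballI)
    fix \<omega> t assume reg: "regular \<omega>" and t: "t \<in> {0..T}"
      and eq: "\<forall>t\<in>{0..T}. YY (J @ [L m]) t \<omega> = I t \<omega> + (\<Sum>\<^sub>\<infinity>u\<in>{0<..t}. jump_term Y YY (J @ [L m]) u \<omega>)"
        "\<forall>t\<in>{0..T}. I t \<omega> = jump_moment J m t \<omega>"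
    obtain D c where D: "step_path T (\<lambda>t. N t \<omega>) D c" using regular_step[OF reg] .
    define w where "w p u = left_lim (\<lambda>v. YY (J0 @ replicate (R - p) (L 1)) v \<omega>) u * 
      jump (\<lambda>v. N v \<omega>) u ^ (p + m)" for p u
    have w: "jump_moment (J0 @ replicate (R - p) (L 1)) (p + m) t \<omega> = (\<Sum>u\<in>D \<inter> {..t}. w p u)" for p
      unfolding jump_moment_def w_def using m(1)
      by (intro infsum_jump_eq_sum[OF D t]) (simp add: zero_power)
    have jt: "jump_term Y YY (J @ [L m]) u \<omega> = (\<Sum>p=1..R. 1 / fact (p + 1) * w p u)" if "u \<in> {0<..T}" for u
      unfolding w_def by (rule jump_term_counting[OF reg that m(1) J])
    have "(\<Sum>\<^sub>\<infinity>u\<in>{0<..t}. jump_term Y YY (J @ [L m]) u \<omega>) 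
      = (\<Sum>u\<in>D \<inter> {..t}. jump_term Y YY (J @ [L m]) u \<omega>)"
      using t m(1) by (intro infsum_jump_eq_sum[OF D t]) (auto simp: jt w_def zero_power)
    also have "\<dots> = (\<Sum>u\<in>D \<inter> {..t}. \<Sum>p=1..R. 1 / fact (p + 1) * w p u)"
      using step_pathD(2)[OF D] by (intro sum.cong jt) auto
    also have "\<dots> = (\<Sum>p=1..R. 1 / fact (p + 1) * (\<Sum>u\<in>D \<inter> {..t}. w p u))"
      by (subst sum.swap) (simp add: sum_distrib_left)
    finally have "YY (J @ [L m]) t \<omega> = jump_moment J m t \<omega> 
      + (\<Sum>p=1..R. 1 / fact (p + 1) * jump_moment (J0 @ replicate (R - p) (L 1)) (p + m) t \<omega>)"
      unfolding w using eq t by simp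
    also have "\<dots> = (\<Sum>p\<le>R. 1 / fact (p + 1) * jump_moment (J0 @ replicate (R - p) (L 1)) (p + m) t \<omega>)"
      using J(2) by (simp add: atMost_atLeast0 sum.atLeast_Suc_atMost)
    finally show "YY (J @ [L m]) t \<omega> 
      = (\<Sum>p\<le>R. 1 / fact (p + 1) * jump_moment (J0 @ replicate (R - p) (L 1)) (p + m) t \<omega>)" .
  qed
qed

lemma tilde_counting:
  assumes "J = J0 @ replicate R (L 1)" "J0 = [] \<or> last J0 \<noteq> L 1"
  shows "tilde J (L 1) = basis (J @ [L 1]) +
    (\<Sum>r=1..R. scale (alpha r) (basis (J0 @ replicate (R - r) (L 1) @ [L (r + 1)])))"
proof -
  have "tilde J (L 1) = basis (J @ [L 1]) + (\<Sum>(J1, J2) | J1 @ J2 = J \<and> J2 \<noteq> [].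
     if set J2 \<subseteq> {L 1} then scale (alpha (length J2)) (basis (J1 @ [L (length J2 + 1)])) else 0)"
    using L by (auto simp: tilde_def case_prod_unfold)
  also have "\<dots> = basis (J @ [L 1]) +
    (\<Sum>r=1..R. scale (alpha r) (basis ((J0 @ replicate (R - r) (L 1)) @ [L (r + 1)])))"
    by (subst sum_constant_suffixes[OF assms]) (rule refl)
  finally show ?thesis by simp
qed

text \<open>
  With \<open>y r\<close> the coordinate that \<open>\<alpha>(r)\<close> multiplies in the tilde transform and \<open>W q\<close> the jump moment
  of order \<open>q + 1\<close>, the signature expansion reads \<open>y r = \<Sum>\<^sub>p W (r + p) / (p + 1)!\<close>, which
  \<open>alpha_inversion\<close> solves for \<open>W 0\<close>, the integral.
\<close>

lemma ito_integral_counting: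
  assumes J: "J \<in> lists {L0, Ls, La 1, Lb 1}" "length J + 1 \<le> M"
    and I: "ito_integral P F T (YY J) (Y (L 1)) I"
  shows "indistinguishable P T I (\<lambda>t \<omega>. pairing (tilde J (L 1)) (\<lambda>K. YY K t \<omega>))"
proof -
  obtain J0 R where R: "J = J0 @ replicate R (L 1)" "J0 = [] \<or> last J0 \<noteq> L 1"
    by (rule maximal_suffix)
  define W where "W q = jump_moment (J0 @ replicate (R - q) (L 1)) (q + 1)" for q
  have "AE \<omega> in P. \<forall>r\<in>{..R}. \<forall>t\<in>{0..T}. YY (J0 @ replicate (R - r) (L 1) @ [L (r + 1)]) t \<omega>
    = (\<Sum>p\<le>R - r. W (r + p) t \<omega> / fact (p + 1))"
  proof (rule AE_finite_allI)
    fix r assume r: "r \<in> {..R}"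
    have "indistinguishable P T (YY ((J0 @ replicate (R - r) (L 1)) @ [L (r + 1)]))
      (\<lambda>t \<omega>. \<Sum>p\<le>R - r. 1 / fact (p + 1) * 
        jump_moment (J0 @ replicate (R - r - p) (L 1)) (p + (r + 1)) t \<omega>)"
      by (rule signature_snoc_counting[OF _ refl R(2)]) (use J R(1) r L in auto)
    then show "AE \<omega> in P. \<forall>t\<in>{0..T}. YY (J0 @ replicate (R - r) (L 1) @ [L (r + 1)]) t \<omega>
      = (\<Sum>p\<le>R - r. W (r + p) t \<omega> / fact (p + 1))"
      unfolding indistinguishable_def
      by eventually_elim (simp add: W_def add.commute add.left_commute)
  qed simp
  then show ?thesis
    unfolding indistinguishable_def 
    using indistinguishableD[OF ito_integral_jump_moment[OF I order_refl]]
  proof (eventually_elim, intro ballI)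
    fix \<omega> t assume t: "t \<in> {0..T}" and I: "\<forall>t\<in>{0..T}. I t \<omega> = jump_moment J 1 t \<omega>"
      and YY: "\<forall>r\<in>{..R}. \<forall>t\<in>{0..T}. YY (J0 @ replicate (R - r) (L 1) @ [L (r + 1)]) t \<omega>
        = (\<Sum>p\<le>R - r. W (r + p) t \<omega> / fact (p + 1))"
    define y where "y r = YY (J0 @ replicate (R - r) (L 1) @ [L (r + 1)]) t \<omega>" for r
    have "pairing (tilde J (L 1)) (\<lambda>K. YY K t \<omega>) = y 0 + (\<Sum>r=1..R. alpha r * y r)"
      unfolding tilde_counting[OF R] pairing_add pairing_basis pairing_sum pairing_scale_basis
      by (simp add: y_def R(1))
    also have "\<dots> = (\<Sum>r\<le>R. alpha_coeff r * y r)"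
      by (simp add: atMost_atLeast0 sum.atLeast_Suc_atMost alpha_coeff_def)
    also have "\<dots> = (\<Sum>r\<le>R. alpha_coeff r * (\<Sum>p\<le>R - r. W (r + p) t \<omega> / fact (p + 1)))"
      using YY t by (simp add: y_def)
    also have "\<dots> = W 0 t \<omega>" by (rule alpha_inversion)
    finally show "I t \<omega> = pairing (tilde J (L 1)) (\<lambda>K. YY K t \<omega>)"
      using I t by (simp add: W_def R(1))
  qed
qed

end

section \<open>Ito integrals of the signature\<close>

lemma (in state_signature) ito_integral_tilde:
  assumes J: "J \<in> lists {L0, Ls, La 1, Lb 1}" "length J + 1 \<le> M" and j: "j \<in> {L0, Ls, La 1, Lb 1}"
    and I: "ito_integral P F T (YY J) (Y j) I"
  shows "indistinguishable P T I (\<lambda>t \<omega>. pairing (tilde J j) (\<lambda>K. YY K t \<omega>))"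
proof -
  have lists: "J \<in> lists (alphabet M)" using J(1) M by (auto simp: alphabet_def)
  consider (counting) "j = La 1 \<or> j = Lb 1" | (price) "J \<noteq> []" "last J = Ls" "j = Ls"
    | (continuous) "j \<in> {L0, Ls}" "J = [] \<or> last J \<noteq> Ls \<or> j \<noteq> Ls"
    using j by auto
  then show ?thesis
  proof cases
    case counting
    interpret a: state_signature_counting P F T S QS Na Nb YY M La Na
      by unfold_locales simp
    interpret b: state_signature_counting P F T S QS Na Nb YY M Lb Nb
      by unfold_locales simp
    show ?thesis
      using counting a.ito_integral_counting[OF J] b.ito_integral_counting[OF J] I by blast
  next
    case price
    have "pairing (tilde J j) x = x (J @ [Ls]) - 1 / 2 * x (butlast J @ [Lqs])" for x
      using price by (simp add: tilde_def pairing_diff pairing_basis pairing_scale_basis)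
    moreover have "indistinguishable P T (YY (J @ [Ls]))
      (\<lambda>t \<omega>. I t \<omega> + 1 / 2 * YY (butlast J @ [Lqs]) t \<omega>)"
      using I price by (intro signature_snoc_price_price[OF lists]) auto
    ultimately show ?thesis
      unfolding indistinguishable_def by (auto elim!: eventually_mono)
  next
    case continuous
    have "pairing (tilde J j) x = x (J @ [j])" for x
      using continuous by (auto simp: tilde_def pairing_basis)
    moreover have "indistinguishable P T (YY (J @ [j])) I"
      using continuous(1) by (intro signature_snoc_continuous_letter[OF lists _ continuous(2) I]) auto
    ultimately show ?thesis
      unfolding indistinguishable_def by (auto elim!: eventually_mono)
  qed
qed

theorem proposition2p6:
  fixes P :: "'a measure" and F :: "real \<Rightarrow> 'a measure" and T :: real
    and S QS Na Nb I :: "real \<Rightarrow> 'a \<Rightarrow> real"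
    and YY :: "letter list \<Rightarrow> real \<Rightarrow> 'a \<Rightarrow> real"
    and M n :: nat and J :: "letter list" and j :: letter
  assumes "filtered_prob_space P F" and "0 < T" and "2 \<le> M"
    and "semimartingale P F T S" and "AE \<omega> in P. continuous_on {0..T} (\<lambda>t. S t \<omega>)"
    and "quad_covariation P F T S S QS"
    and "counting_process P F T Na" and "counting_process P F T Nb"
    and "AE \<omega> in P. \<forall>t\<in>{0<..T}. jump (\<lambda>u. Na u \<omega>) t * jump (\<lambda>u. Nb u \<omega>) t = 0"
    and "signature P F T (alphabet M) (state_process S QS Na Nb) YY"
    and "J \<in> lists {L0, Ls, La 1, Lb 1}" and "length J = n"
    and "j \<in> {L0, Ls, La 1, Lb 1}"
    and "n + 1 \<le> M"
    and "ito_integral P F T (YY J) (state_process S QS Na Nb j) I"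
  shows "\<forall>t\<in>{0..T}. AE \<omega> in P. I t \<omega> = pairing (tilde J j) (\<lambda>K. YY K t \<omega>)"
proof -
  interpret filtered_prob_space P F by fact
  interpret state_signature P F T S QS Na Nb YY M
    using assms by unfold_locales auto
  have "indistinguishable P T I (\<lambda>t \<omega>. pairing (tilde J j) (\<lambda>K. YY K t \<omega>))"
    using assms by (intro ito_integral_tilde) auto
  then show ?thesis
    unfolding indistinguishable_def by (auto elim!: eventually_mono)
qed

end
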